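(* Let $k\geq 1$. There are no (nonempty) real hypersurfaces with isometric Reeb flow in the odd-dimensional complex quadric $Q^{2k+1}$.
   Context: The complex quadric $Q^m=\{[z]\in{\mathbb C}P^{m+1}\mid z_1^2+\ldots+z_{m+2}^2=0\}$ ($=SO_{m+2}/SO_mSO_2$) is equipped with the complex structure $J$ and the Riemannian metric $g$ induced from ${\mathbb C}P^{m+1}$ with the Fubini-Study metric of constant holomorphic sectional curvature $4$. A real hypersurface $M\subset Q^m$ is a submanifold of real codimension one (not assumed complete). For a (local) unit normal vector field $N$ of $M$, the vector field $\xi=-JN$ on $M$ is the Reeb vector field, and its flow is the Reeb flow. The Reeb flow is isometric if $\xi$ is a Killing vector field on $M$ for the induced metric (this does not depend on the sign of $N$). *)

theory Defs
  imports "HOL-Analysis.Analysis"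
begin

section \<open>Smooth maps on open subsets of normed spaces\<close>

primrec Ck_on :: "nat \<Rightarrow> 'a set \<Rightarrow> ('a::real_normed_vector \<Rightarrow> 'b::real_normed_vector) \<Rightarrow> bool" where
  "Ck_on 0 S f \<longleftrightarrow> continuous_on S f"
| "Ck_on (Suc k) S f \<longleftrightarrow>
     (\<forall>x\<in>S. f differentiable (at x)) \<and>
     (\<forall>v. Ck_on k S (\<lambda>x. frechet_derivative f (at x) v))"

definition smooth_on :: "'a set \<Rightarrow> ('a::real_normed_vector \<Rightarrow> 'b::real_normed_vector) \<Rightarrow> bool" where
  "smooth_on S f \<longleftrightarrow> (\<forall>k. Ck_on k S f)"

text \<open>Lie derivative of a covariant 2-tensor along a vector field, in linear coordinates:
  \<open>(L_V h)_ij = V^k d_k h_ij + h_kj d_i V^k + h_ik d_j V^k\<close>.\<close>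

definition lie_derivative ::
  "('a::real_normed_vector \<Rightarrow> 'a) \<Rightarrow> ('a \<Rightarrow> 'a \<Rightarrow> 'a \<Rightarrow> real) \<Rightarrow> 'a \<Rightarrow> 'a \<Rightarrow> 'a \<Rightarrow> real" where
  "lie_derivative V h z x y =
     frechet_derivative (\<lambda>w. h w x y) (at z) (V z)
     + h z (frechet_derivative V (at z) x) y
     + h z x (frechet_derivative V (at z) y)"


section \<open>Complex projective space and the complex quadric\<close>

text \<open>If \<open>'n\<close> has \<open>N\<close> elements, the points of the projective space \<open>CP^(N-1)\<close> are the complex
  lines through the origin of \<open>complex ^ 'n\<close>.\<close>

definition proj_point :: "complex ^ 'n \<Rightarrow> (complex ^ 'n) set" where
  "proj_point z = vec.span {z}"

definition proj_space :: "(complex ^ 'n) set set" where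
  "proj_space = proj_point ` {z. z \<noteq> 0}"

text \<open>The complex quadric \<open>Q^m\<close>, where \<open>m + 2 = CARD('n)\<close>.\<close>

definition complex_quadric :: "(complex ^ 'n) set set" where
  "complex_quadric = proj_point ` {z. z \<noteq> 0 \<and> (\<Sum>i\<in>UNIV. (z $ i)\<^sup>2) = 0}"

text \<open>Preimage under the projection \<open>complex ^ 'n - {0} \<rightarrow> CP^(N-1)\<close>.  This projection is a quotient
  map and a surjective submersion.  So openness of a set of points and smoothness of a function on
  projective space are tested on preimages, and tangent vectors and vector fields are represented
  by lifts: \<open>v\<close> at \<open>z\<close> stands for the image of \<open>v\<close> under the differential of the projection at
  \<open>z\<close>, the kernel of which is the complex line spanned by \<open>z\<close>; moreover \<open>v\<close> at \<open>z\<close> and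
  \<open>c *s v\<close> at \<open>c *s z\<close> represent the same tangent vector.\<close>

definition proj_preimage :: "(complex ^ 'n) set set \<Rightarrow> (complex ^ 'n) set" where
  "proj_preimage S = {z. z \<noteq> 0 \<and> proj_point z \<in> S}"

definition open_in_proj :: "(complex ^ 'n) set set \<Rightarrow> bool" where
  "open_in_proj U \<longleftrightarrow> U \<subseteq> proj_space \<and> open (proj_preimage U)"

definition hermitian :: "complex ^ 'n \<Rightarrow> complex ^ 'n \<Rightarrow> complex" where
  "hermitian v w = (\<Sum>i\<in>UNIV. v $ i * cnj (w $ i))"

text \<open>The Fubini-Study metric, in homogeneous coordinates, pulled back to \<open>complex ^ 'n - {0}\<close>.
  With this normalization the projection from the unit sphere is a Riemannian submersion, and the
  holomorphic sectional curvature is 4.\<close>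

definition fubini_study :: "complex ^ 'n \<Rightarrow> complex ^ 'n \<Rightarrow> complex ^ 'n \<Rightarrow> real" where
  "fubini_study z v w =
     Re ((hermitian v w * hermitian z z - hermitian v z * hermitian z w) / (hermitian z z)\<^sup>2)"

text \<open>The complex structure of projective space; it preserves the tangent spaces of the quadric
  and restricts to the complex structure of the quadric.\<close>

definition complex_structure :: "complex ^ 'n \<Rightarrow> complex ^ 'n" where
  "complex_structure v = \<i> *s v"

text \<open>Lifts at \<open>z\<close> of the tangent vectors of a submanifold \<open>S\<close> of projective space, given as
  velocities of curves.  (For a submanifold, differentiability of the curve at the one parameter
  value gives the same vectors as smoothness.)\<close>

definition lifted_tangent :: "(complex ^ 'n) set set \<Rightarrow> complex ^ 'n \<Rightarrow> (complex ^ 'n) set" where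
  "lifted_tangent S z =
     {v. \<exists>\<gamma> :: real \<Rightarrow> complex ^ 'n. \<gamma> 0 = z \<and> (\<gamma> has_vector_derivative v) (at 0) \<and>
           (\<forall>\<^sub>F t in nhds 0. \<gamma> t \<in> proj_preimage S)}"


section \<open>Real hypersurfaces of the quadric\<close>

text \<open>An embedded submanifold of real codimension one of the quadric: locally the zero set in the
  quadric of a smooth real function whose restriction to the quadric has nonzero differential at
  each of these zeros.  No closedness or completeness is required.\<close>

definition real_hypersurface :: "(complex ^ 'n) set set \<Rightarrow> bool" where
  "real_hypersurface M \<longleftrightarrow> M \<subseteq> complex_quadric \<and>
     (\<forall>p\<in>M. \<exists>U (f :: (complex ^ 'n) set \<Rightarrow> real).
        open_in_proj U \<and> p \<in> U \<and>
        smooth_on (proj_preimage U) (\<lambda>z. f (proj_point z)) \<and>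
        M \<inter> U = {q \<in> complex_quadric \<inter> U. f q = 0} \<and>
        (\<forall>z\<in>proj_preimage (M \<inter> U). \<exists>v\<in>lifted_tangent complex_quadric z.
           frechet_derivative (\<lambda>w. f (proj_point w)) (at z) v \<noteq> 0))"

text \<open>A smooth unit normal field on the open part \<open>M \<inter> U\<close> of \<open>M\<close>, as a map \<open>N\<close> defined over \<open>U\<close>
  of which only the values over \<open>M \<inter> U\<close> matter.  Over \<open>M \<inter> U\<close>, it is the horizontal lift of a
  vector field: homogeneous under scaling and orthogonal to the fibres.\<close>

definition unit_normal_field ::
  "(complex ^ 'n) set set \<Rightarrow> (complex ^ 'n) set set \<Rightarrow> (complex ^ 'n \<Rightarrow> complex ^ 'n) \<Rightarrow> bool" where
  "unit_normal_field M U N \<longleftrightarrow> open_in_proj U \<and> smooth_on (proj_preimage U) N \<and>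
     (\<forall>z\<in>proj_preimage (M \<inter> U).
        (\<forall>c. c \<noteq> 0 \<longrightarrow> N (c *s z) = c *s N z) \<and> hermitian (N z) z = 0 \<and>
        N z \<in> lifted_tangent complex_quadric z \<and>
        (\<forall>v\<in>lifted_tangent M z. fubini_study z (N z) v = 0) \<and>
        fubini_study z (N z) (N z) = 1)"

definition reeb_field :: "(complex ^ 'n \<Rightarrow> complex ^ 'n) \<Rightarrow> complex ^ 'n \<Rightarrow> complex ^ 'n" where
  "reeb_field N z = - complex_structure (N z)"

text \<open>For a field \<open>V\<close> tangent to \<open>M\<close> along \<open>M \<inter> U\<close>: the Lie derivative along \<open>V\<close> of the metric
  induced on \<open>M\<close> vanishes.  As \<open>V\<close> is tangent to \<open>M\<close>, the restriction to \<open>M\<close> of the Lie derivative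
  of the ambient metric is the Lie derivative of the induced metric and depends only on the values
  of \<open>V\<close> over \<open>M\<close>; likewise taking Lie derivatives commutes with lifting from projective space.\<close>

definition killing_field_on ::
  "(complex ^ 'n) set set \<Rightarrow> (complex ^ 'n) set set \<Rightarrow> (complex ^ 'n \<Rightarrow> complex ^ 'n) \<Rightarrow> bool" where
  "killing_field_on M U V \<longleftrightarrow>
     (\<forall>z\<in>proj_preimage (M \<inter> U). \<forall>x\<in>lifted_tangent M z. \<forall>y\<in>lifted_tangent M z.
        lie_derivative V fubini_study z x y = 0)"

text \<open>Local unit normal fields exist around each point of a hypersurface and are unique up to
  sign, on which the Killing condition does not depend.\<close>

definition isometric_reeb_flow :: "(complex ^ 'n) set set \<Rightarrow> bool" where
  "isometric_reeb_flow M \<longleftrightarrow>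
     (\<forall>p\<in>M. \<exists>U N. p \<in> U \<and> unit_normal_field M U N \<and> killing_field_on M U (reeb_field N))"

end

theory Submission
  imports Defs
begin

text \<open>
The argument is local and takes place on the cone over the hypersurface.  Let \<open>n = CARD('n)\<close>, let
\<open>bil\<close> be the complex bilinear form whose null cone defines the quadric, and \<open>vcnj\<close> complex
conjugation.  The preimage \<open>K\<close> of \<open>M\<close> is a real hypersurface of the cone \<open>bil z z = 0\<close>, and the
unit normal field lifts to a map \<open>N\<close>.  At a point \<open>z\<close> of norm 1, the tangent space of the quadric
is the orthogonal complement of \<open>z\<close> and \<open>vcnj z\<close>, and \<open>vcnj\<close> acts on it as one of the real
structures of the quadric.  The derivative \<open>L\<close> of \<open>N\<close> along \<open>K\<close> is, up to components along
\<open>z\<close> and \<open>vcnj z\<close>, the negative of the shape operator.  So \<open>L\<close> is symmetric, and the Killing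
equation for \<open>- \<i> N\<close> says that the bilinear form \<open>L x \<bullet> \<i> y\<close> is skew.

Both identities can be differentiated once more along \<open>K\<close>.  Since second derivatives commute, this
is the Codazzi equation together with the covariant derivative of the Killing equation.  On the
maximal complex subspace \<open>C\<close> of the tangent space of \<open>M\<close>, the second derivative \<open>E\<close> of \<open>N\<close>,
corrected by a term built from \<open>bil\<close>, becomes a totally symmetric cubic form that changes sign
when \<open>\<i>\<close> is moved from one argument to another; such a form vanishes (\<open>R_C\<close>).  Inserting the
Reeb direction gives a quadratic equation for \<open>L\<close> on \<open>C\<close> (\<open>hopf_quadratic\<close>), all terms of which
are invariant under \<open>\<i>\<close>, except the one with \<open>bil N N\<close>, which changes sign.  For \<open>n \<ge> 5\<close> this
forces \<open>bil N N = 0\<close>: the normal is isotropic (\<open>bil_NN_zero\<close>).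

Differentiating \<open>bil N N = 0\<close> twice along \<open>K\<close>, and using the formula for \<open>E\<close> that \<open>R_C\<close> provides,
gives \<open>L (vcnj (L u)) = - vcnj u\<close> on the orthogonal complement \<open>Q\<close> of \<open>z, vcnj z, N, vcnj N\<close>.
Hence the antilinear map \<open>L \<circ> vcnj\<close> has square \<open>- 1\<close> on \<open>Q\<close>, that is, it is a quaternionic
structure.  So the complex dimension \<open>n - 4\<close> of \<open>Q\<close> is even (\<open>isotropic_contradiction\<close>), whereas
\<open>n = 2 k + 3\<close> is odd.
\<close>

section \<open>Differential calculus\<close>

lemma Ck_on_subset: "Ck_on k A f \<Longrightarrow> B \<subseteq> A \<Longrightarrow> Ck_on k B f"
  by (induction k arbitrary: f) (auto intro: continuous_on_subset)

lemma smooth_on_subset: "smooth_on A f \<Longrightarrow> B \<subseteq> A \<Longrightarrow> smooth_on B f"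
  unfolding smooth_on_def using Ck_on_subset by blast

lemma smooth_on_first:
  assumes "smooth_on S f" "z \<in> S"
  shows "(f has_derivative frechet_derivative f (at z)) (at z)"
proof -
  have "Ck_on (Suc 0) S f" using assms(1) unfolding smooth_on_def by blast
  then show ?thesis using assms(2) by (auto simp: frechet_derivative_works)
qed

lemma smooth_on_second:
  assumes "smooth_on S f" "z \<in> S"
  shows "((\<lambda>w. frechet_derivative f (at w) y) has_derivative
    frechet_derivative (\<lambda>w. frechet_derivative f (at w) y) (at z)) (at z)"
proof -
  have "Ck_on (Suc (Suc 0)) S f" using assms(1) unfolding smooth_on_def by blast
  then show ?thesis using assms(2) by (auto simp: frechet_derivative_works)
qed

text \<open>The mean value theorem, applied once, in the direction \<open>u\<close>, expresses the second difference by
values of \<open>DG _ u\<close>; differentiability of \<open>DG _ u\<close> at the single point \<open>z\<close> then suffices for the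
limit.  As the difference is symmetric in \<open>u\<close> and \<open>v\<close>, this yields the symmetry of second
derivatives.\<close>
lemma second_difference_tendsto:
  fixes G :: "'a::real_normed_vector \<Rightarrow> real"
  assumes S: "open S" "z \<in> S" and D: "\<And>w. w \<in> S \<Longrightarrow> (G has_derivative DG w) (at w)"
    and A: "((\<lambda>w. DG w u) has_derivative A) (at z)"
  shows "((\<lambda>t. (G (z + t *\<^sub>R u + t *\<^sub>R v) - G (z + t *\<^sub>R u) - G (z + t *\<^sub>R v) + G z) / t\<^sup>2)
    \<longlongrightarrow> A v) (at_right 0)"
proof (rule tendstoI)
  fix e :: real assume e: "e > 0"
  define k where "k = 2 * norm u + norm v + 1"
  have k: "k > 0" unfolding k_def by (smt (verit) norm_ge_zero)
  define e' where "e' = e / (2 * k)"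
  have e': "e' > 0" using e k by (simp add: e'_def)
  from S obtain r where r: "r > 0" "\<And>w. norm (w - z) < r \<Longrightarrow> w \<in> S"
    unfolding open_dist by (metis dist_norm)
  from A obtain d where d: "d > 0"
    "\<And>y. norm (y - z) < d \<Longrightarrow> norm (DG y u - DG z u - A (y - z)) \<le> e' * norm (y - z)"
    unfolding has_derivative_at_alt using e' by blast
  have linA: "linear A" using A by (rule has_derivative_linear)
  define m where "m = min r d / k"
  have m: "m > 0" using r d k by (simp add: m_def)
  have "dist ((G (z + t *\<^sub>R u + t *\<^sub>R v) - G (z + t *\<^sub>R u) - G (z + t *\<^sub>R v) + G z) / t\<^sup>2) (A v) < e"
    if t: "0 < t" "t < m" for t
  proof -
    have tk: "t * k < min r d" using t k by (simp add: m_def field_simps)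
    have n1: "norm (s *\<^sub>R u) \<le> t * norm u" if "0 \<le> s" "s \<le> t" for s
      using that by (simp add: mult_right_mono)
    have n2: "norm (s *\<^sub>R u + t *\<^sub>R v) \<le> t * norm u + t * norm v" if "0 \<le> s" "s \<le> t" for s
      using norm_triangle_ineq[of "s *\<^sub>R u" "t *\<^sub>R v"] n1[OF that] t by simp
    have tt: "t * norm u + t * norm v < min r d" "t * norm u < min r d"
    proof -
      have "t * norm u + t * norm v \<le> t * k" "t * norm u \<le> t * k"
        using t by (simp_all add: k_def flip: distrib_left)
      then show "t * norm u + t * norm v < min r d" "t * norm u < min r d" using tk by simp_all
    qed
    define \<phi> where "\<phi> s = G (z + s *\<^sub>R u + t *\<^sub>R v) - G (z + s *\<^sub>R u)" for s
    have der: "(\<phi> has_real_derivative (DG (z + s *\<^sub>R u + t *\<^sub>R v) u - DG (z + s *\<^sub>R u) u)) (at s)"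
      if s: "0 \<le> s" "s \<le> t" for s
    proof -
      have 1: "z + s *\<^sub>R u + t *\<^sub>R v \<in> S" "z + s *\<^sub>R u \<in> S"
        using n1[OF s] n2[OF s] tt by (auto intro!: r(2) simp: add.assoc)
      have a: "((\<lambda>s. G (z + s *\<^sub>R u + t *\<^sub>R v)) has_derivative (\<lambda>h. DG (z + s *\<^sub>R u + t *\<^sub>R v) (h *\<^sub>R u))) (at s)"
        by (rule has_derivative_compose[where g = G and f = "\<lambda>s. z + s *\<^sub>R u + t *\<^sub>R v", OF _ D[OF 1(1)]]) (auto intro!: derivative_eq_intros)
      have b: "((\<lambda>s. G (z + s *\<^sub>R u)) has_derivative (\<lambda>h. DG (z + s *\<^sub>R u) (h *\<^sub>R u))) (at s)"
        by (rule has_derivative_compose[where g = G and f = "\<lambda>s. z + s *\<^sub>R u", OF _ D[OF 1(2)]]) (auto intro!: derivative_eq_intros)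
      have l: "linear (DG (z + s *\<^sub>R u + t *\<^sub>R v))" "linear (DG (z + s *\<^sub>R u))"
        using D[OF 1(1)] D[OF 1(2)] by (auto dest: has_derivative_linear)
      have c: "(\<lambda>h. DG (z + s *\<^sub>R u + t *\<^sub>R v) (h *\<^sub>R u) - DG (z + s *\<^sub>R u) (h *\<^sub>R u))
          = (*) (DG (z + s *\<^sub>R u + t *\<^sub>R v) u - DG (z + s *\<^sub>R u) u)"
        by (rule ext) (simp only: linear_scale[OF l(1)] linear_scale[OF l(2)] real_scaleR_def
            right_diff_distrib[symmetric] mult.commute)
      show ?thesis
        using has_derivative_diff[OF a b] unfolding \<phi>_def has_field_derivative_def c .
    qed
    obtain s where s: "0 < s" "s < t"
      "\<phi> t - \<phi> 0 = t * (DG (z + s *\<^sub>R u + t *\<^sub>R v) u - DG (z + s *\<^sub>R u) u)"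
      using MVT2[OF t(1) der] by auto
    let ?p = "s *\<^sub>R u + t *\<^sub>R v" and ?q = "s *\<^sub>R u"
    have p: "norm (DG (z + ?p) u - DG z u - A ?p) \<le> e' * norm ?p"
      using d(2)[of "z + ?p"] n2[of s] s tt by simp
    have q: "norm (DG (z + ?q) u - DG z u - A ?q) \<le> e' * norm ?q"
      using d(2)[of "z + ?q"] n1[of s] s tt by simp
    have Apq: "A ?p - A ?q = t * A v" by (simp add: linear_add[OF linA] linear_scale[OF linA])
    have "e' * norm ?p + e' * norm ?q = e' * (norm ?p + norm ?q)" by (simp add: distrib_left)
    also have "\<dots> \<le> e' * (t * k)"
      using n1[of s] n2[of s] s e' t by (intro mult_left_mono) (auto simp: k_def algebra_simps)
    finally have "\<bar>DG (z + ?p) u - DG (z + ?q) u - t * A v\<bar> \<le> e' * (t * k)"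
      using p q Apq unfolding real_norm_def by linarith
    also have "\<dots> = t * (e / 2)" using k by (simp add: e'_def)
    finally have 2: "\<bar>DG (z + ?p) u - DG (z + ?q) u - t * A v\<bar> \<le> t * (e / 2)" .
    have "(G (z + t *\<^sub>R u + t *\<^sub>R v) - G (z + t *\<^sub>R u) - G (z + t *\<^sub>R v) + G z) / t\<^sup>2 - A v
      = (\<phi> t - \<phi> 0 - t\<^sup>2 * A v) / t\<^sup>2"
      using t by (simp add: \<phi>_def field_simps)
    also have "\<dots> = (DG (z + ?p) u - DG (z + ?q) u - t * A v) / t"
      using t unfolding s(3) by (simp add: power2_eq_square field_simps)
    also have "\<bar>\<dots>\<bar> \<le> e / 2" using 2 t by (simp add: abs_divide field_simps)
    finally show ?thesis using e by (simp add: dist_real_def)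
  qed
  then show "\<forall>\<^sub>F t in at_right 0. dist ((G (z + t *\<^sub>R u + t *\<^sub>R v) - G (z + t *\<^sub>R u)
      - G (z + t *\<^sub>R v) + G z) / t\<^sup>2) (A v) < e"
    unfolding eventually_at_right_field using m by auto
qed

lemma second_derivative_symmetric:
  fixes G :: "'a::real_normed_vector \<Rightarrow> real"
  assumes S: "open S" "z \<in> S" and D: "\<And>w. w \<in> S \<Longrightarrow> (G has_derivative DG w) (at w)"
    and A: "((\<lambda>w. DG w u) has_derivative A) (at z)"
    and B: "((\<lambda>w. DG w v) has_derivative B) (at z)"
  shows "A v = B u"
proof -
  have "((\<lambda>t. (G (z + t *\<^sub>R u + t *\<^sub>R v) - G (z + t *\<^sub>R u) - G (z + t *\<^sub>R v) + G z) / t\<^sup>2)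
      \<longlongrightarrow> A v) (at_right 0)"
    using S D A by (rule second_difference_tendsto)
  moreover have "((\<lambda>t. (G (z + t *\<^sub>R v + t *\<^sub>R u) - G (z + t *\<^sub>R v) - G (z + t *\<^sub>R u) + G z) / t\<^sup>2)
      \<longlongrightarrow> B u) (at_right 0)"
    using S D B by (rule second_difference_tendsto)
  moreover have "G (z + t *\<^sub>R v + t *\<^sub>R u) - G (z + t *\<^sub>R v) - G (z + t *\<^sub>R u)
    = G (z + t *\<^sub>R u + t *\<^sub>R v) - G (z + t *\<^sub>R u) - G (z + t *\<^sub>R v)" for t
    by (simp add: add_ac)
  ultimately show ?thesis
    by (simp only:) (rule tendsto_unique[OF trivial_limit_at_right_real])
qed

lemma second_derivative_symmetric_vector:
  fixes G :: "'a::real_normed_vector \<Rightarrow> 'b::euclidean_space"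
  assumes S: "open S" "z \<in> S" and D: "\<And>w. w \<in> S \<Longrightarrow> (G has_derivative DG w) (at w)"
    and A: "((\<lambda>w. DG w u) has_derivative A) (at z)"
    and B: "((\<lambda>w. DG w v) has_derivative B) (at z)"
  shows "A v = B u"
proof (rule euclidean_eqI)
  fix b :: 'b assume "b \<in> Basis"
  show "A v \<bullet> b = B u \<bullet> b"
    using S by (rule second_derivative_symmetric[where G = "\<lambda>w. G w \<bullet> b" and DG = "\<lambda>w h. DG w h \<bullet> b"])
      (intro has_derivative_inner_left D A B; assumption)+
qed

text \<open>Inside the plane spanned by \<open>v\<close> and \<open>w\<close>, the function is \<open>s * G' w\<close> up to an error that is small
compared with \<open>\<bar>t\<bar>\<close>.  So it changes sign between \<open>s = - e * \<bar>t\<bar>\<close> and \<open>s = e * \<bar>t\<bar>\<close>.\<close>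
lemma zero_near_line:
  fixes G :: "'a::real_normed_vector \<Rightarrow> real"
  assumes G0: "G 0 = 0" and der: "(G has_derivative G') (at 0)"
    and r: "0 < r" and cont: "continuous_on (ball 0 r) G"
    and v: "G' v = 0" and w: "G' w \<noteq> 0" and e: "e > 0"
  shows "\<exists>d>0. \<forall>t. 0 < \<bar>t\<bar> \<and> \<bar>t\<bar> < d \<longrightarrow> (\<exists>s. \<bar>s\<bar> \<le> e * \<bar>t\<bar> \<and> G (t *\<^sub>R v + s *\<^sub>R w) = 0)"
proof -
  define k where "k = norm v + e * norm w + 1"
  have "0 \<le> norm v" "0 \<le> e * norm w" using e by simp_all
  then have k: "k > 0" unfolding k_def by linarith
  \<comment> \<open>With this error bound, the remainder is at most half of the linear term at the two endpoints.\<close>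
  define e' where "e' = e * \<bar>G' w\<bar> / (2 * k)"
  have e': "e' > 0" using e w k by (simp add: e'_def)
  have "\<exists>d>0. \<forall>y. norm (y - 0) < d \<longrightarrow> norm (G y - G 0 - G' (y - 0)) \<le> e' * norm (y - 0)"
    using der e' unfolding has_derivative_at_alt by blast
  then obtain d where d: "d > 0"
    "\<And>y. norm y < d \<Longrightarrow> norm (G y - G' y) \<le> e' * norm y"
    unfolding G0 diff_zero by blast
  have lin: "linear G'" using der by (rule has_derivative_linear)
  have "\<exists>s. \<bar>s\<bar> \<le> e * \<bar>t\<bar> \<and> G (t *\<^sub>R v + s *\<^sub>R w) = 0"
    if t: "0 < \<bar>t\<bar>" "\<bar>t\<bar> < min r d / k" for t
  proof -
    let ?b = "e * \<bar>t\<bar>"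
    have b: "?b > 0" using e t by simp
    have tk: "\<bar>t\<bar> * k < min r d" using t k by (simp add: field_simps)
    have n: "norm (t *\<^sub>R v + s *\<^sub>R w) \<le> \<bar>t\<bar> * k" if "\<bar>s\<bar> \<le> ?b" for s
    proof -
      have "norm (t *\<^sub>R v + s *\<^sub>R w) \<le> \<bar>t\<bar> * norm v + \<bar>s\<bar> * norm w"
        using norm_triangle_ineq[of "t *\<^sub>R v" "s *\<^sub>R w"] by simp
      also have "\<bar>s\<bar> * norm w \<le> ?b * norm w" using that by (intro mult_right_mono) auto
      finally show ?thesis by (simp add: k_def algebra_simps)
    qed
    define g where "g s = G (t *\<^sub>R v + s *\<^sub>R w)" for s
    have cg: "continuous_on {- ?b..?b} g"
      unfolding g_def
    proof (rule continuous_on_compose2[OF cont])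
      show "(\<lambda>s. t *\<^sub>R v + s *\<^sub>R w) ` {- ?b..?b} \<subseteq> ball 0 r"
      proof
        fix x assume "x \<in> (\<lambda>s. t *\<^sub>R v + s *\<^sub>R w) ` {- ?b..?b}"
        then obtain s where "x = t *\<^sub>R v + s *\<^sub>R w" "s \<in> {- ?b..?b}" by blast
        then have "x = t *\<^sub>R v + s *\<^sub>R w" "\<bar>s\<bar> \<le> ?b" by auto
        then show "x \<in> ball 0 r" using n[of s] tk by simp
      qed
    qed (intro continuous_intros)
    have est: "\<bar>g s - s * G' w\<bar> < ?b * \<bar>G' w\<bar>" if "\<bar>s\<bar> \<le> ?b" for s
    proof -
      have "\<bar>g s - s * G' w\<bar> \<le> e' * norm (t *\<^sub>R v + s *\<^sub>R w)"
        using d(2)[of "t *\<^sub>R v + s *\<^sub>R w"] n[OF that] tk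
        by (simp add: g_def linear_add[OF lin] linear_scale[OF lin] v)
      also have "\<dots> \<le> e' * (\<bar>t\<bar> * k)" using n[OF that] e' by (intro mult_left_mono) auto
      also have "\<dots> = ?b * \<bar>G' w\<bar> / 2" using k by (simp add: e'_def)
      also have "\<dots> < ?b * \<bar>G' w\<bar>"
      proof -
        have "0 < ?b * \<bar>G' w\<bar>" using b w by (intro mult_pos_pos[OF b]) simp
        then show ?thesis by linarith
      qed
      finally show ?thesis .
    qed
    have e1: "\<bar>g ?b - ?b * G' w\<bar> < ?b * \<bar>G' w\<bar>" and e2: "\<bar>g (- ?b) + ?b * G' w\<bar> < ?b * \<bar>G' w\<bar>"
      using est[of ?b] est[of "- ?b"] b by simp_all
    have "\<exists>s. - ?b \<le> s \<and> s \<le> ?b \<and> g s = 0"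
    proof (cases "G' w > 0")
      case True
      then have "\<bar>G' w\<bar> = G' w" by simp
      then have "g (- ?b) \<le> 0" "0 \<le> g ?b"
        using e1 e2 unfolding abs_less_iff by (simp_all only:) linarith+
      then show ?thesis using IVT'[of g "- ?b" 0 ?b] cg b by auto
    next
      case False
      then have "\<bar>G' w\<bar> = - G' w" by simp
      then have "g ?b \<le> 0" "0 \<le> g (- ?b)"
        using e1 e2 unfolding abs_less_iff by (simp_all only: mult_minus_right) linarith+
      then show ?thesis using IVT2'[of g ?b 0 "- ?b"] cg b by auto
    qed
    then show ?thesis by (auto simp: g_def abs_le_iff)
  qed
  moreover have "min r d / k > 0" using r d k by simp
  ultimately show ?thesis by blast
qed

text \<open>A kernel vector of the derivative is the velocity of a curve in the zero set.  The curve is only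
required to be differentiable at the one parameter value, so the intermediate value theorem replaces
the implicit function theorem: any choice of nearly minimal zeros \<open>s t\<close> is \<open>o(t)\<close>.\<close>
lemma zero_curve:
  fixes G :: "'a::real_normed_vector \<Rightarrow> real"
  assumes G0: "G 0 = 0" and der: "(G has_derivative G') (at 0)"
    and r: "0 < r" and cont: "continuous_on (ball 0 r) G"
    and v: "G' v = 0" and w: "G' w \<noteq> 0"
  obtains s where "s 0 = 0" "(s has_real_derivative 0) (at 0)"
    "\<forall>\<^sub>F t in nhds 0. G (t *\<^sub>R v + s t *\<^sub>R w) = 0"
proof -
  note near = zero_near_line[OF assms]
  define Z where "Z t = {s. G (t *\<^sub>R v + s *\<^sub>R w) = 0}" for t
  \<comment> \<open>The summand \<open>t\<^sup>2\<close> makes room for a zero that need not attain the infimum.\<close>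
  define s where "s t = (if t = 0 then 0 else SOME s. s \<in> Z t \<and> \<bar>s\<bar> \<le> Inf (abs ` Z t) + t\<^sup>2)" for t
  have bdd: "bdd_below (abs ` Z t)" for t by (rule bdd_belowI[of _ 0]) auto
  have s: "s t \<in> Z t \<and> \<bar>s t\<bar> \<le> \<bar>a\<bar> + t\<^sup>2" if t: "t \<noteq> 0" and a: "a \<in> Z t" for t a
  proof -
    have "Inf (abs ` Z t) < Inf (abs ` Z t) + t\<^sup>2" using that by simp
    then obtain x where "x \<in> abs ` Z t" "x < Inf (abs ` Z t) + t\<^sup>2"
      using cInf_lessD[of "abs ` Z t" "Inf (abs ` Z t) + t\<^sup>2"] a by auto
    then have "\<exists>x. x \<in> Z t \<and> \<bar>x\<bar> \<le> Inf (abs ` Z t) + t\<^sup>2" by auto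
    from someI_ex[OF this] have "s t \<in> Z t" "\<bar>s t\<bar> \<le> Inf (abs ` Z t) + t\<^sup>2"
      using that by (simp_all add: s_def)
    moreover have "Inf (abs ` Z t) \<le> \<bar>a\<bar>" using that bdd by (intro cInf_lower) auto
    ultimately show ?thesis by auto
  qed
  have s0: "s 0 = 0" by (simp add: s_def)
  have "(s has_derivative (\<lambda>h. 0)) (at 0)"
    unfolding has_derivative_at_alt
  proof (intro conjI allI impI)
    fix e :: real assume e: "e > 0"
    obtain d where d: "d > 0" "\<And>t. 0 < \<bar>t\<bar> \<Longrightarrow> \<bar>t\<bar> < d \<Longrightarrow>
        \<exists>s. \<bar>s\<bar> \<le> e / 2 * \<bar>t\<bar> \<and> G (t *\<^sub>R v + s *\<^sub>R w) = 0"
      using near[of "e / 2"] e by auto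
    have "\<bar>s t\<bar> \<le> e * \<bar>t\<bar>" if t: "\<bar>t\<bar> < min d (e / 2)" for t
    proof (cases "t = 0")
      case False
      then obtain a where a: "\<bar>a\<bar> \<le> e / 2 * \<bar>t\<bar>" "a \<in> Z t"
        using d(2)[of t] t by (auto simp: Z_def)
      have "t\<^sup>2 = \<bar>t\<bar> * \<bar>t\<bar>" by (simp add: power2_eq_square)
      also have "\<dots> \<le> e / 2 * \<bar>t\<bar>" using t by (intro mult_right_mono) auto
      finally show ?thesis using s[OF False a(2)] a(1) by linarith
    qed (simp add: s0)
    then show "\<exists>d>0. \<forall>y. norm (y - 0) < d \<longrightarrow> norm (s y - s 0 - 0) \<le> e * norm (y - 0)"
      using d(1) e by (intro exI[of _ "min d (e / 2)"]) (simp add: s0)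
  qed simp
  moreover have "\<forall>\<^sub>F t in nhds 0. G (t *\<^sub>R v + s t *\<^sub>R w) = 0"
  proof -
    obtain d where d: "d > 0" "\<And>t. 0 < \<bar>t\<bar> \<Longrightarrow> \<bar>t\<bar> < d \<Longrightarrow>
        \<exists>s. \<bar>s\<bar> \<le> 1 * \<bar>t\<bar> \<and> G (t *\<^sub>R v + s *\<^sub>R w) = 0"
      using near[of 1] by auto
    have "G (t *\<^sub>R v + s t *\<^sub>R w) = 0" if t: "\<bar>t\<bar> < d" for t
    proof (cases "t = 0")
      case False
      then obtain a where "a \<in> Z t" using d(2)[of t] t by (auto simp: Z_def)
      then show ?thesis using s[OF False] by (auto simp: Z_def)
    qed (simp add: s0 G0)
    then show ?thesis
      unfolding eventually_nhds_metric using d(1) by (auto simp: dist_real_def)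
  qed
  moreover have "(*) (0::real) = (\<lambda>h. 0)" by auto
  ultimately show ?thesis using s0 that[of s] unfolding has_field_derivative_def by simp
qed

text \<open>The product rule for a derivative applied to a moving vector.  Only the partial maps \<open>D _ y\<close>
are assumed to be differentiable; in finite dimension this is enough, by expansion in a basis.\<close>
lemma has_derivative_moving:
  fixes Y :: "'c::real_normed_vector \<Rightarrow> 'a::euclidean_space"
    and D :: "'c \<Rightarrow> 'a \<Rightarrow> 'b::real_normed_vector"
  assumes S: "open S" "z \<in> S" and lin: "\<And>w. w \<in> S \<Longrightarrow> linear (D w)"
    and D2: "\<And>y. ((\<lambda>w. D w y) has_derivative (\<lambda>u. D2 u y)) (at z)"
    and Y: "(Y has_derivative Y') (at z)"
  shows "((\<lambda>w. D w (Y w)) has_derivative (\<lambda>u. D2 u (Y z) + D z (Y' u))) (at z)"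
proof -
  have expand: "D w y = (\<Sum>i\<in>Basis. (y \<bullet> i) *\<^sub>R D w i)" if "w \<in> S" for w y
    using linear_sum[OF lin[OF that], of "\<lambda>i. (y \<bullet> i) *\<^sub>R i" Basis]
    by (simp add: linear_scale[OF lin[OF that]] euclidean_representation)
  have D2exp: "D2 u y = (\<Sum>i\<in>Basis. (y \<bullet> i) *\<^sub>R D2 u i)" for u y
  proof -
    have "((\<lambda>w. \<Sum>i\<in>Basis. (y \<bullet> i) *\<^sub>R D w i) has_derivative (\<lambda>u. \<Sum>i\<in>Basis. (y \<bullet> i) *\<^sub>R D2 u i)) (at z)"
      by (intro has_derivative_sum has_derivative_scaleR_right D2)
    then have "((\<lambda>w. D w y) has_derivative (\<lambda>u. \<Sum>i\<in>Basis. (y \<bullet> i) *\<^sub>R D2 u i)) (at z)"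
      by (rule has_derivative_transform_within_open[OF _ S]) (simp add: expand)
    from has_derivative_unique[OF D2 this] show ?thesis by (simp add: fun_eq_iff)
  qed
  have "((\<lambda>w. \<Sum>i\<in>Basis. (Y w \<bullet> i) *\<^sub>R D w i) has_derivative
      (\<lambda>u. \<Sum>i\<in>Basis. (Y z \<bullet> i) *\<^sub>R D2 u i + (Y' u \<bullet> i) *\<^sub>R D z i)) (at z)"
    by (intro has_derivative_sum has_derivative_scaleR has_derivative_inner_left D2 Y)
  then have "((\<lambda>w. D w (Y w)) has_derivative
      (\<lambda>u. \<Sum>i\<in>Basis. (Y z \<bullet> i) *\<^sub>R D2 u i + (Y' u \<bullet> i) *\<^sub>R D z i)) (at z)"
    by (rule has_derivative_transform_within_open[OF _ S]) (simp add: expand[symmetric])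
  also have "(\<lambda>u. \<Sum>i\<in>Basis. (Y z \<bullet> i) *\<^sub>R D2 u i + (Y' u \<bullet> i) *\<^sub>R D z i)
      = (\<lambda>u. D2 u (Y z) + D z (Y' u))"
    using S(2) by (simp add: fun_eq_iff sum.distrib expand[of z "Y' _"] D2exp[of _ "Y z"])
  finally show ?thesis .
qed

definition velocities :: "'a::real_normed_vector set \<Rightarrow> 'a \<Rightarrow> 'a set" where
  "velocities A z = {v. \<exists>\<gamma> :: real \<Rightarrow> 'a. \<gamma> 0 = z \<and> (\<gamma> has_vector_derivative v) (at 0) \<and>
     (\<forall>\<^sub>F t in nhds 0. \<gamma> t \<in> A)}"

lemma velocities_mono: "A \<subseteq> B \<Longrightarrow> velocities A z \<subseteq> velocities B z"
  unfolding velocities_def by (blast intro: eventually_mono)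

lemma derivative_along_velocity:
  assumes v: "v \<in> velocities A z" and D: "(\<Phi> has_derivative \<Phi>') (at z)"
    and 0: "\<And>w. w \<in> A \<Longrightarrow> \<Phi> w = 0"
  shows "\<Phi>' v = 0"
proof -
  from v obtain \<gamma> where g: "\<gamma> 0 = z" "(\<gamma> has_vector_derivative v) (at 0)"
    "\<forall>\<^sub>F t in nhds 0. \<gamma> t \<in> A" unfolding velocities_def by blast
  have "((\<lambda>t. \<Phi> (\<gamma> t)) has_derivative (\<lambda>h. \<Phi>' (h *\<^sub>R v))) (at 0)"
    using has_derivative_compose[of \<gamma> "\<lambda>h. h *\<^sub>R v" 0 UNIV \<Phi> \<Phi>'] g(2) D
    unfolding has_vector_derivative_def g(1) by blast
  moreover have "((\<lambda>t. \<Phi> (\<gamma> t)) has_derivative (\<lambda>h. 0)) (at 0)"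
  proof (rule has_derivative_transform_eventually[of "\<lambda>_. 0"])
    show "\<forall>\<^sub>F t in at 0. 0 = \<Phi> (\<gamma> t)"
      unfolding eventually_at_filter by (rule eventually_mono[OF g(3)]) (simp add: 0)
    show "0 = \<Phi> (\<gamma> 0)" using eventually_nhds_x_imp_x[OF g(3)] 0 by simp
  qed auto
  ultimately have "(\<lambda>h. \<Phi>' (h *\<^sub>R v)) = (\<lambda>h. 0)" by (rule has_derivative_unique)
  from fun_cong[OF this, of 1] show ?thesis by simp
qed

section \<open>Hermitian and bilinear forms\<close>

definition vcnj :: "complex ^ 'n \<Rightarrow> complex ^ 'n" where
  "vcnj v = (\<chi> i. cnj (v $ i))"

text \<open>The bilinear form \<open>bil\<close> is the polarization of the equation of the quadric.\<close>
definition bil :: "complex ^ 'n \<Rightarrow> complex ^ 'n \<Rightarrow> complex" where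
  "bil v w = (\<Sum>i\<in>UNIV. v $ i * w $ i)"

lemma hermitian_simps:
  fixes x y w :: "complex ^ 'n::finite"
  shows "hermitian (x + y) w = hermitian x w + hermitian y w"
    and "hermitian w (x + y) = hermitian w x + hermitian w y"
    and "hermitian (x - y) w = hermitian x w - hermitian y w"
    and "hermitian w (x - y) = hermitian w x - hermitian w y"
    and "hermitian (- x) w = - hermitian x w"
    and "hermitian w (- x) = - hermitian w x"
    and "hermitian 0 w = 0" and "hermitian w 0 = 0"
    and "hermitian (c *s x) w = c * hermitian x w"
    and "hermitian w (c *s x) = cnj c * hermitian w x"
    and "hermitian (r *\<^sub>R x) w = of_real r * hermitian x w"
    and "hermitian w (r *\<^sub>R x) = of_real r * hermitian w x"
  by (auto simp: hermitian_def sum.distrib sum_subtractf sum_negf sum_distrib_left algebra_simps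
      scaleR_conv_of_real[where 'a = complex])

lemma bil_simps:
  fixes x y w :: "complex ^ 'n::finite"
  shows "bil (x + y) w = bil x w + bil y w"
    and "bil w (x + y) = bil w x + bil w y"
    and "bil (x - y) w = bil x w - bil y w"
    and "bil w (x - y) = bil w x - bil w y"
    and "bil (- x) w = - bil x w"
    and "bil w (- x) = - bil w x"
    and "bil 0 w = 0" and "bil w 0 = 0"
    and "bil (c *s x) w = c * bil x w"
    and "bil w (c *s x) = c * bil w x"
    and "bil (r *\<^sub>R x) w = of_real r * bil x w"
    and "bil w (r *\<^sub>R x) = of_real r * bil w x"
  by (auto simp: bil_def sum.distrib sum_subtractf sum_negf sum_distrib_left algebra_simps
      scaleR_conv_of_real[where 'a = complex])

lemma vcnj_simps [simp]:
  "vcnj (vcnj x) = x" "vcnj (x + y) = vcnj x + vcnj y" "vcnj (x - y) = vcnj x - vcnj y"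
  "vcnj (- x) = - vcnj x" "vcnj 0 = 0" "vcnj (c *s x) = cnj c *s vcnj x"
  "vcnj (r *\<^sub>R x) = r *\<^sub>R vcnj x"
  by (auto simp: vcnj_def vec_eq_iff)

lemma hermitian_commute: "hermitian x y = cnj (hermitian y x)"
  by (auto simp: hermitian_def mult.commute)

lemma bil_commute: "bil x y = bil y x"
  by (auto simp: bil_def mult.commute)

lemma hermitian_vcnj_right [simp]: "hermitian x (vcnj y) = bil x y"
  and hermitian_vcnj_left: "hermitian (vcnj x) y = cnj (bil x y)"
  and bil_vcnj_right [simp]: "bil x (vcnj y) = hermitian x y"
  and bil_vcnj_left: "bil (vcnj x) y = cnj (hermitian x y)"
  by (auto simp: hermitian_def bil_def vcnj_def)

lemma inner_eq_Re_hermitian: "x \<bullet> y = Re (hermitian x y)"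
  by (simp add: hermitian_def inner_vec_def inner_complex_def)

lemma hermitian_self: "hermitian x x = of_real (x \<bullet> x)"
  by (simp add: inner_eq_Re_hermitian hermitian_def complex_eq_iff mult.commute)

lemma scale_i_i [simp]: "\<i> *s (\<i> *s x) = - (x :: complex ^ 'n)"
  by (simp add: vec_eq_iff)

lemma inner_scale_i: "x \<bullet> (\<i> *s y) = - ((\<i> *s x) \<bullet> y)"
  "(\<i> *s x) \<bullet> (\<i> *s y) = x \<bullet> y"
  by (simp_all add: inner_eq_Re_hermitian hermitian_simps)

lemma hermitian_eq_inner: "hermitian x y = Complex (x \<bullet> y) (x \<bullet> (\<i> *s y))"
  by (simp add: inner_eq_Re_hermitian hermitian_simps complex_eq_iff)

lemma bounded_bilinear_hermitian: "bounded_bilinear (hermitian :: complex ^ 'n::finite \<Rightarrow> _)"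
  unfolding bilinear_conv_bounded_bilinear[symmetric] bilinear_def
  by (auto intro!: linearI simp: hermitian_simps scaleR_conv_of_real[where 'a = complex])

lemma bounded_bilinear_bil: "bounded_bilinear (bil :: complex ^ 'n::finite \<Rightarrow> _)"
  unfolding bilinear_conv_bounded_bilinear[symmetric] bilinear_def
  by (auto intro!: linearI simp: bil_simps scaleR_conv_of_real[where 'a = complex])

lemma bounded_bilinear_scale: "bounded_bilinear ((*s) :: complex \<Rightarrow> complex ^ 'n::finite \<Rightarrow> _)"
  unfolding bilinear_conv_bounded_bilinear[symmetric] bilinear_def
  by (auto intro!: linearI simp: vec_eq_iff algebra_simps)

lemma bounded_linear_vcnj: "bounded_linear (vcnj :: complex ^ 'n::finite \<Rightarrow> _)"
  unfolding linear_conv_bounded_linear[symmetric] by (auto intro!: linearI)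

lemmas has_derivative_hermitian = bounded_bilinear.FDERIV[OF bounded_bilinear_hermitian]
lemmas has_derivative_bil = bounded_bilinear.FDERIV[OF bounded_bilinear_bil]
lemmas has_derivative_scale = bounded_bilinear.FDERIV[OF bounded_bilinear_scale]
lemmas has_derivative_vcnj = bounded_linear.has_derivative[OF bounded_linear_vcnj]

lemma fubini_study_orthogonal:
  assumes "hermitian y z = 0" "z \<noteq> 0"
  shows "fubini_study z a y = (a \<bullet> y) / (z \<bullet> z)" "fubini_study z y a = (y \<bullet> a) / (z \<bullet> z)"
proof -
  have "hermitian z y = 0" using assms hermitian_commute[of z y] by simp
  then show "fubini_study z a y = (a \<bullet> y) / (z \<bullet> z)" "fubini_study z y a = (y \<bullet> a) / (z \<bullet> z)"
    using assms
    by (simp_all add: fubini_study_def hermitian_self inner_eq_Re_hermitian[of a y]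
        inner_eq_Re_hermitian[of y a] power2_eq_square)
qed

text \<open>The Fubini-Study metric depends on the base point only through the norm of \<open>z\<close> and through terms that
vanish to second order for horizontal \<open>x\<close> and \<open>y\<close>; a horizontal \<open>v\<close> preserves the norm.\<close>
lemma fubini_study_derivative_orthogonal:
  assumes z: "z \<noteq> 0" and h: "hermitian x z = 0" "hermitian y z = 0" "hermitian v z = 0"
  shows "frechet_derivative (\<lambda>w. fubini_study w x y) (at z) v = 0"
proof -
  have h': "hermitian z y = 0" "hermitian z v = 0"
    using h hermitian_commute[of z y] hermitian_commute[of z v] by simp_all
  have nz: "(hermitian z z)\<^sup>2 \<noteq> 0" using z by (simp add: hermitian_self)
  have B: "((\<lambda>w. hermitian w w) has_derivative (\<lambda>u. hermitian z u + hermitian u z)) (at z)"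
    by (intro has_derivative_hermitian has_derivative_ident)
  define A' where "A' u = (hermitian x y * (hermitian z u + hermitian u z)) -
      (hermitian x z * (hermitian z 0 + hermitian u y) + (hermitian x u + hermitian 0 z) * hermitian z y)" for u
  have A: "((\<lambda>w. hermitian x y * hermitian w w - hermitian x w * hermitian w y) has_derivative A') (at z)"
    unfolding A'_def
    by (intro has_derivative_diff has_derivative_mult_right B has_derivative_mult
        has_derivative_hermitian has_derivative_ident has_derivative_const)
  note D = bounded_linear.has_derivative[OF bounded_linear_Re
      has_derivative_divide'[OF A has_derivative_power[OF B, of 2] nz]]
  have "frechet_derivative (\<lambda>w. fubini_study w x y) (at z)
    = (\<lambda>u. Re ((A' u * (hermitian z z)\<^sup>2 - (hermitian x y * hermitian z z - hermitian x z * hermitian z y) *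
        (of_nat 2 * (hermitian z u + hermitian u z) * hermitian z z ^ (2 - 1))) / ((hermitian z z)\<^sup>2 * (hermitian z z)\<^sup>2)))"
    unfolding fubini_study_def by (rule frechet_derivative_at[OF D, symmetric])
  then show ?thesis by (simp add: A'_def h h' hermitian_simps)
qed

section \<open>Pointwise consequences of the Codazzi and Killing equations\<close>

text \<open>At a point \<open>z\<close> of the cone with \<open>N\<close> normal to it, this is the tangent space of the cone over the
hypersurface.  It contains the complex line spanned by \<open>z\<close>, the kernel of the projection.\<close>
definition tangent_at where
  "tangent_at z N = {v. bil v z = 0 \<and> v \<bullet> N = 0}"

text \<open>The 2-jet of the normal field at a point \<open>z\<close> of norm 1: \<open>L\<close> is the derivative of \<open>N\<close> and \<open>E u x\<close>
the derivative in direction \<open>u\<close> of \<open>L\<close> applied to a tangent field through \<open>x\<close>, namely the field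
whose derivative at \<open>z\<close> in direction \<open>u\<close> is \<open>- (bil x u *s vcnj z + (x \<bullet> L u) *\<^sub>R N)\<close>.  This derivative is
symmetric in \<open>u\<close> and \<open>x\<close>, which is why \<open>E\<close> is.  The assumptions \<open>EN\<close>, \<open>Dsym\<close> and \<open>Dkill\<close> are the
derivatives of \<open>L x \<bullet> N = x \<bullet> z\<close>, of \<open>sym\<close> and of \<open>kill\<close>.\<close>
locale reeb_jet =
  fixes z N :: "complex ^ 'n::finite" and L :: "complex ^ 'n \<Rightarrow> complex ^ 'n"
    and E :: "complex ^ 'n \<Rightarrow> complex ^ 'n \<Rightarrow> complex ^ 'n" and H
  defines "H \<equiv> {v \<in> tangent_at z N. v \<bullet> z = 0}"
  assumes zz: "hermitian z z = 1" and bzz: "bil z z = 0"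
    and Nz: "hermitian N z = 0" and bNz: "bil N z = 0" and NN: "hermitian N N = 1"
    and linL: "linear L"
    and Lz: "x \<in> H \<Longrightarrow> hermitian (L x) z = - hermitian N x"
    and bLz: "x \<in> H \<Longrightarrow> bil (L x) z = - bil N x"
    and LN: "x \<in> H \<Longrightarrow> L x \<bullet> N = 0"
    and sym: "\<lbrakk>x \<in> H; y \<in> H\<rbrakk> \<Longrightarrow> L x \<bullet> y = L y \<bullet> x"
    and kill: "\<lbrakk>x \<in> H; y \<in> H\<rbrakk> \<Longrightarrow> L x \<bullet> (\<i> *s y) + L y \<bullet> (\<i> *s x) = 0"
    and Esym: "\<lbrakk>u \<in> H; x \<in> H\<rbrakk> \<Longrightarrow> E u x = E x u"
    and EN: "\<lbrakk>u \<in> H; x \<in> H\<rbrakk> \<Longrightarrow> E u x \<bullet> N + L x \<bullet> L u = x \<bullet> u"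
    and Dsym: "\<lbrakk>u \<in> H; x \<in> H; y \<in> H\<rbrakk> \<Longrightarrow>
        E u x \<bullet> y - L x \<bullet> (bil y u *s vcnj z + (y \<bullet> L u) *\<^sub>R N)
      = E u y \<bullet> x - L y \<bullet> (bil x u *s vcnj z + (x \<bullet> L u) *\<^sub>R N)"
    and Dkill: "\<lbrakk>u \<in> H; x \<in> H; y \<in> H\<rbrakk> \<Longrightarrow>
        E u x \<bullet> (\<i> *s y) - L x \<bullet> (\<i> *s (bil y u *s vcnj z + (y \<bullet> L u) *\<^sub>R N))
      + E u y \<bullet> (\<i> *s x) - L y \<bullet> (\<i> *s (bil x u *s vcnj z + (x \<bullet> L u) *\<^sub>R N)) = 0"
begin

text \<open>\<open>C\<close> is the maximal complex subspace of the horizontal tangent space \<open>H\<close>; its orthogonal complement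
in \<open>H\<close> is spanned by the Reeb direction \<open>\<i> *s N\<close>.\<close>
definition "C = {v. hermitian v z = 0 \<and> bil v z = 0 \<and> hermitian v N = 0}"

text \<open>Subtracting this multiple of \<open>bil\<close> turns the Codazzi equation into total symmetry.\<close>
definition "R u x y = E u x \<bullet> y - Re (cnj (bil x u) * bil N y)"

lemma C_H: "x \<in> C \<Longrightarrow> x \<in> H"
  by (auto simp: C_def H_def tangent_at_def inner_eq_Re_hermitian)

lemma C_i: "x \<in> C \<Longrightarrow> \<i> *s x \<in> C"
  by (auto simp: C_def hermitian_simps bil_simps)

lemma iN_H: "\<i> *s N \<in> H"
  using Nz bNz NN
  by (auto simp: H_def tangent_at_def inner_eq_Re_hermitian hermitian_simps bil_simps)

text \<open>The hypersurface is Hopf: \<open>L\<close> maps the Reeb direction to itself, up to components along \<open>z\<close> and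
\<open>vcnj z\<close>.  This is the Killing equation with the Reeb direction as one argument, since \<open>\<i>\<close> maps it
to \<open>- N\<close> and \<open>L x\<close> is orthogonal to \<open>N\<close>.\<close>
lemma L_iN_C: "x \<in> C \<Longrightarrow> L (\<i> *s N) \<bullet> x = 0" and L_C_iN: "x \<in> C \<Longrightarrow> L x \<bullet> (\<i> *s N) = 0"
proof -
  have *: "L (\<i> *s N) \<bullet> (\<i> *s x) = 0" if "x \<in> C" for x
    using kill[OF C_H[OF that] iN_H] LN[OF C_H[OF that]] by (simp)
  show 1: "L (\<i> *s N) \<bullet> x = 0" if "x \<in> C" for x
    using *[OF C_i[OF that]] by simp
  show "x \<in> C \<Longrightarrow> L x \<bullet> (\<i> *s N) = 0"
    using 1[of x] sym[OF C_H iN_H] by simp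
qed

lemma R_swap12: "\<lbrakk>u \<in> H; x \<in> H\<rbrakk> \<Longrightarrow> R u x y = R x u y"
  by (simp add: R_def Esym[of u x] bil_commute[of x u])

lemma L_cnj_z: "x \<in> H \<Longrightarrow> L x \<bullet> (c *s vcnj z) = - Re (cnj c * bil N x)"
  by (simp add: inner_eq_Re_hermitian hermitian_simps bLz)

lemma R_swap23:
  assumes "u \<in> H" "x \<in> H" "y \<in> H" shows "R u x y = R u y x"
  using Dsym[OF assms] LN[OF assms(2)] LN[OF assms(3)] L_cnj_z[OF assms(2)] L_cnj_z[OF assms(3)]
  by (simp add: R_def inner_add_right)

text \<open>The derivative of the Killing equation.  The correction in \<open>R\<close> absorbs the terms with \<open>bil\<close>, so
that the right-hand side vanishes when \<open>x\<close> and \<open>y\<close> lie in \<open>C\<close>.\<close>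
lemma R_i:
  assumes "u \<in> H" "x \<in> H" "y \<in> H"
  shows "R u x (\<i> *s y) + R u y (\<i> *s x)
    = (y \<bullet> L u) * (L x \<bullet> (\<i> *s N)) + (x \<bullet> L u) * (L y \<bullet> (\<i> *s N))"
proof -
  have *: "L x \<bullet> (\<i> *s (bil y u *s vcnj z + (y \<bullet> L u) *\<^sub>R N))
    = - Re (cnj (\<i> * bil y u) * bil N x) + (y \<bullet> L u) * (L x \<bullet> (\<i> *s N))" if "x \<in> H" for x y
  proof -
    have "\<i> *s (bil y u *s vcnj z + (y \<bullet> L u) *\<^sub>R N)
      = (\<i> * bil y u) *s vcnj z + (y \<bullet> L u) *\<^sub>R (\<i> *s N)"
      by (simp add: vec_eq_iff algebra_simps)
    then show ?thesis using L_cnj_z[OF that] by (simp only: inner_add_right inner_scaleR_right)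
  qed
  show ?thesis
    using Dkill[OF assms] unfolding *[OF assms(2)] *[OF assms(3)] R_def
    by (simp add: bil_simps algebra_simps)
qed

text \<open>By \<open>R_i\<close> and the symmetries, moving \<open>\<i>\<close> from one argument of \<open>R\<close> to another changes the sign.
Moving it around three arguments brings it back to where it was with the sign \<open>- 1\<close>.\<close>
lemma R_C:
  assumes "u \<in> C" "x \<in> C" "y \<in> C" shows "R u x y = 0"
proof -
  note H = C_H C_i
  have i23: "R u x (\<i> *s y) = - R u (\<i> *s x) y" if "u \<in> C" "x \<in> C" "y \<in> C" for u x y
    using R_i[of u x y] R_swap23[of u y "\<i> *s x"] that L_C_iN by (simp add: H)
  have i12: "R u (\<i> *s x) y = - R (\<i> *s u) x y" if "u \<in> C" "x \<in> C" "y \<in> C" for u x y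
  proof -
    have "R u (\<i> *s x) y = R u y (\<i> *s x)" using that by (simp add: R_swap23 H)
    also have "\<dots> = R y u (\<i> *s x)" using that by (simp add: R_swap12 H)
    also have "\<dots> = - R y (\<i> *s u) x" using that i23 by simp
    also have "R y (\<i> *s u) x = R (\<i> *s u) y x" using that by (simp add: R_swap12 H)
    also have "\<dots> = R (\<i> *s u) x y" using that by (simp add: R_swap23 H)
    finally show ?thesis .
  qed
  have 0: "R (\<i> *s u) x y = 0" if "u \<in> C" "x \<in> C" "y \<in> C" for u x y
  proof -
    have "R (\<i> *s u) x y = - R u (\<i> *s x) y" using i12 that by simp
    also have "\<dots> = R u x (\<i> *s y)" using i23 that by simp
    also have "\<dots> = R u (\<i> *s y) x" using that by (simp add: R_swap23 H)
    also have "\<dots> = - R (\<i> *s u) y x" using i12 that by simp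
    also have "\<dots> = - R (\<i> *s u) x y" using that by (simp add: R_swap23 H)
    finally show ?thesis by simp
  qed
  have "R (\<i> *s (\<i> *s (\<i> *s (\<i> *s u)))) x y = 0"
    by (intro 0 C_i assms)
  then show ?thesis by simp
qed

lemma L_i_C:
  assumes "x \<in> C" shows "L (\<i> *s x) = \<i> *s L x"
proof -
  define d where "d = L (\<i> *s x) - \<i> *s L x"
  have hLN: "hermitian (L x) N = 0" if "x \<in> C" for x
    using LN[OF C_H[OF that]] L_C_iN[OF that] by (simp add: hermitian_eq_inner complex_eq_iff)
  note xi = C_i[OF assms]
  have hx: "hermitian N x = 0" using assms hermitian_commute[of N x] by (simp add: C_def)
  have dC: "d \<in> C"
    using hLN[OF assms] hLN[OF xi] Lz[OF C_H[OF assms]] Lz[OF C_H[OF xi]] hx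
      bLz[OF C_H[OF assms]] bLz[OF C_H[OF xi]]
    by (auto simp: C_def d_def hermitian_simps bil_simps)
  have "d \<bullet> y = 0" if "y \<in> C" for y
  proof -
    have "L (\<i> *s x) \<bullet> y = L y \<bullet> (\<i> *s x)" using sym C_H that xi by simp
    also have "\<dots> = - (L x \<bullet> (\<i> *s y))" using kill[of x y] C_H that assms by fastforce
    also have "\<dots> = (\<i> *s L x) \<bullet> y" by (simp add: inner_scale_i)
    finally show ?thesis by (simp add: d_def inner_diff_left)
  qed
  with dC have "d = 0" by force
  then show ?thesis by (simp add: d_def)
qed

text \<open>With the Reeb direction as one argument, \<open>R\<close> can be computed in two ways: by \<open>R_i\<close> and \<open>EN\<close> it is the
difference of the two sides, which is symmetric in \<open>u\<close> and \<open>x\<close>; by \<open>R_i\<close> with the Reeb direction in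
the first place it is skew.\<close>
lemma hopf_quadratic:
  assumes "u \<in> C" "x \<in> C"
  shows "(L (\<i> *s N) \<bullet> (\<i> *s N)) * (x \<bullet> L u) + x \<bullet> u - L x \<bullet> L u
     = Re (cnj (bil x u) * bil N N)" (is "?F u x = ?G u x")
proof -
  note H = C_H iN_H C_i
  have *: "R (\<i> *s N) u (\<i> *s x) = ?F u x - ?G u x" if "u \<in> C" "x \<in> C" for u x
  proof -
    have "R u x (\<i> *s (\<i> *s N)) + R u (\<i> *s N) (\<i> *s x) = (x \<bullet> L u) * (L (\<i> *s N) \<bullet> (\<i> *s N))"
      using R_i[of u x "\<i> *s N"] L_C_iN[of u] that by (simp add: H inner_commute)
    moreover have "R u (\<i> *s N) (\<i> *s x) = R (\<i> *s N) u (\<i> *s x)"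
      using that R_swap12 H by metis
    moreover have "R u x (\<i> *s (\<i> *s N)) = - (x \<bullet> u - L x \<bullet> L u) + ?G u x"
      using EN[of u x] that H by (simp add: R_def bil_simps)
    ultimately show ?thesis by (simp add: algebra_simps)
  qed
  have "R (\<i> *s N) u (\<i> *s x) + R (\<i> *s N) x (\<i> *s u) = 0"
    using R_i[of "\<i> *s N" u x] L_iN_C[of u] L_iN_C[of x] assms by (simp add: H inner_commute)
  then have "(?F u x - ?G u x) + (?F x u - ?G x u) = 0"
    unfolding *[OF assms] *[OF assms(2,1)] .
  moreover have "?F u x = ?F x u"
    using sym[of x u] assms H by (auto simp: inner_commute)
  moreover have "?G u x = ?G x u" by (simp add: bil_commute[of u x])
  ultimately have "2 * (?F u x - ?G u x) = 0" by (simp only: mult_2)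
  then show ?thesis by (simp only: mult_eq_0_iff) simp
qed

text \<open>Replacing \<open>u, x\<close> by \<open>\<i> *s u, \<i> *s x\<close> in \<open>hopf_quadratic\<close> changes only the sign of the right-hand side,
so that side is zero.  For a vector \<open>v\<close> orthogonal to \<open>z, vcnj z, N, vcnj N\<close>, both \<open>v\<close> and
\<open>vcnj v\<close> lie in \<open>C\<close>, and \<open>bil v (vcnj v) \<noteq> 0\<close>; using \<open>v\<close> and \<open>\<i> *s v\<close> disposes of the real and the
imaginary part of \<open>bil N N\<close>.  Such a \<open>v\<close> exists because four complex conditions leave room in
dimension at least 5.\<close>
lemma bil_NN_zero:
  assumes "CARD('n) \<ge> 5" shows "bil N N = 0"
proof -
  \<comment> \<open>Complex orthogonality to four vectors is real orthogonality to these eight.\<close>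
  define xs where "xs = [z, \<i> *s z, vcnj z, \<i> *s vcnj z, N, \<i> *s N, vcnj N, \<i> *s vcnj N]"
  have "dim (set xs) \<le> card (set xs)" by (rule dim_le_card[OF span_superset finite_set])
  moreover have "card (set xs) \<le> length xs" by (rule card_length)
  moreover have "length xs = 8" by (simp add: xs_def)
  moreover have "8 < DIM(complex ^ 'n)" using assms by simp
  ultimately have "dim (set xs) < DIM(complex ^ 'n)" by linarith
  from orthogonal_to_subspace_exists[OF this]
  obtain v where v: "v \<noteq> 0" "\<And>y. y \<in> span (set xs) \<Longrightarrow> orthogonal v y"
    by auto
  have o: "v \<bullet> y = 0" if "y \<in> set xs" for y
    using v(2)[OF span_base[OF that]] by (simp only: orthogonal_def)
  have "v \<bullet> z = 0" "v \<bullet> (\<i> *s z) = 0" "v \<bullet> vcnj z = 0" "v \<bullet> (\<i> *s vcnj z) = 0"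
    "v \<bullet> N = 0" "v \<bullet> (\<i> *s N) = 0" "v \<bullet> vcnj N = 0" "v \<bullet> (\<i> *s vcnj N) = 0"
    by (rule o, simp add: xs_def)+
  then have h: "hermitian v z = 0" "hermitian v (vcnj z) = 0" "hermitian v N = 0"
    "hermitian v (vcnj N) = 0"
    unfolding hermitian_eq_inner complex_eq_iff by simp_all
  then have vC: "v \<in> C" "vcnj v \<in> C"
    by (simp_all add: C_def hermitian_vcnj_left bil_vcnj_left)
  have *: "Re (cnj (bil x u) * bil N N) = 0" if "x \<in> C" "u \<in> C" for x u
  proof -
    have "x \<bullet> L u = (\<i> *s x) \<bullet> L (\<i> *s u)" "L x \<bullet> L u = L (\<i> *s x) \<bullet> L (\<i> *s u)"
      "x \<bullet> u = (\<i> *s x) \<bullet> (\<i> *s u)"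
      using that by (simp_all add: L_i_C inner_scale_i)
    moreover have "Re (cnj (bil (\<i> *s x) (\<i> *s u)) * bil N N) = - Re (cnj (bil x u) * bil N N)"
      by (simp add: bil_simps)
    ultimately have "Re (cnj (bil x u) * bil N N) = - Re (cnj (bil x u) * bil N N)"
      using hopf_quadratic[OF that(2,1)] hopf_quadratic[OF C_i[OF that(2)] C_i[OF that(1)]]
      by metis
    then show ?thesis by (simp only: equal_neg_zero)
  qed
  have "Re (hermitian v v * bil N N) = 0" "Re (- \<i> * hermitian v v * bil N N) = 0"
    using *[OF vC] *[OF C_i[OF vC(1)] vC(2)] by (simp_all add: bil_simps hermitian_simps hermitian_self)
  then show ?thesis using v(1) by (simp add: hermitian_self complex_eq_iff)
qed

text \<open>The hypotheses \<open>t\<close>, \<open>t1\<close> and \<open>t2\<close> are the isotropy of the normal and its first two derivatives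
along the cone.  By \<open>R_C\<close> with \<open>vcnj N\<close> as third argument, \<open>bil (E u x) N\<close> has the same real part as
\<open>bil x u\<close>, so that \<open>L \<circ> vcnj\<close> squares to \<open>- 1\<close> on \<open>Q\<close>.\<close>
lemma isotropic_contradiction:
  assumes odd: "odd CARD('n)" and t: "bil N N = 0"
    and t1: "\<And>x. x \<in> H \<Longrightarrow> bil (L x) N = 0"
    and t2: "\<And>u x. \<lbrakk>u \<in> H; x \<in> H\<rbrakk> \<Longrightarrow> bil (E u x) N + bil (L x) (L u) = 0"
  shows False
proof -
  define Q where "Q = {v \<in> C. bil v N = 0}"
  have hNz: "hermitian z N = 0" "bil z N = 0"
    using Nz bNz hermitian_commute[of z N] bil_commute[of z N] by auto
  have QC: "x \<in> Q \<Longrightarrow> x \<in> C" "x \<in> Q \<Longrightarrow> x \<in> H" for x by (auto simp: Q_def C_H)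
  have Qc: "x \<in> Q \<Longrightarrow> vcnj x \<in> Q" for x
    by (auto simp: Q_def C_def hermitian_vcnj_left bil_vcnj_left)
  have QL: "L x \<in> Q" if "x \<in> Q" for x
  proof -
    have "hermitian N x = 0" "bil N x = 0"
      using that hermitian_commute[of N x] bil_commute[of N x] by (auto simp: Q_def C_def)
    then show ?thesis
      using that Lz[of x] bLz[of x] t1[of x] LN[of x] L_C_iN[of x] QC[OF that]
      by (auto simp: Q_def C_def hermitian_eq_inner[of "L x" N] complex_eq_iff)
  qed
  have Qadd: "x \<in> Q \<Longrightarrow> y \<in> Q \<Longrightarrow> x + y \<in> Q" for x y
    by (auto simp: Q_def C_def hermitian_simps bil_simps)
  have Qscale: "x \<in> Q \<Longrightarrow> c *s x \<in> Q" for x c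
    by (auto simp: Q_def C_def hermitian_simps bil_simps)
  have cN: "vcnj N \<in> C"
    using t Nz bNz by (auto simp: C_def hermitian_vcnj_left bil_vcnj_left)
  have Reb: "Re (bil (L x) (L u)) = - Re (bil x u)" if "x \<in> Q" "u \<in> Q" for x u
  proof -
    have "E u x \<bullet> vcnj N = Re (cnj (bil x u) * bil N (vcnj N))"
      using R_C[of u x "vcnj N"] QC that cN by (simp add: R_def)
    then show ?thesis
      using t2[of u x] QC that NN by (simp add: inner_eq_Re_hermitian complex_eq_iff)
  qed
  have quat: "L (vcnj (L u)) = - vcnj u" if u: "u \<in> Q" for u
  proof -
    let ?w = "L (vcnj (L u)) + vcnj u"
    have wQ: "?w \<in> Q" using u by (intro Qadd QL Qc)
    have "?w \<bullet> x = 0" if x: "x \<in> Q" for x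
    proof -
      have "L (vcnj (L u)) \<bullet> x = L x \<bullet> vcnj (L u)"
        using u x by (intro sym QC Qc QL)
      also have "\<dots> = - Re (bil x u)"
        using Reb[OF x u] by (simp add: inner_eq_Re_hermitian)
      also have "\<dots> = - (vcnj u \<bullet> x)"
        by (simp add: inner_eq_Re_hermitian hermitian_vcnj_left bil_commute)
      finally show ?thesis by (simp add: inner_add_left)
    qed
    from this[OF wQ] show ?thesis by (simp add: add_eq_0_iff2)
  qed
  have LQ: "L (c *s x) = c *s L x" if "x \<in> Q" for x c
  proof -
    have c: "c *s x = Re c *\<^sub>R x + Im c *\<^sub>R (\<i> *s x)" for x :: "complex ^ 'n"
      by (simp add: vec_eq_iff complex_eq_iff)
    show ?thesis
      unfolding c[of x] c[of "L x"]
      by (simp add: linear_add[OF linL] linear_scale[OF linL] L_i_C[OF QC(1)[OF that]])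
  qed
  \<comment> \<open>\<open>P\<close> is the orthogonal projection to \<open>Q\<close>.  On the span of \<open>z, vcnj z, N, vcnj N\<close>, the map \<open>K\<close> is
    chosen such that \<open>K \<circ> vcnj\<close> exchanges \<open>z\<close> with \<open>N\<close>, and \<open>vcnj z\<close> with \<open>vcnj N\<close>, up to signs, and
    squares to \<open>- 1\<close> there as well.  So the parity can be read off from a determinant on the whole space.\<close>
  define P where "P v = v - hermitian v z *s z - bil v z *s vcnj z - hermitian v N *s N - bil v N *s vcnj N" for v
  define K where "K v = L (P v) + bil v z *s N - bil v N *s z + hermitian v z *s vcnj N - hermitian v N *s vcnj z" for v
  note hs = hermitian_simps bil_simps hermitian_vcnj_left bil_vcnj_left zz NN bzz Nz bNz hNz t
  have PQ: "P v \<in> Q" for v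
    by (simp add: Q_def C_def P_def hs)
  have PQ_id: "P v = v" if "v \<in> Q" for v using that by (simp add: P_def Q_def C_def)
  have Ladd: "L (x + y) = L x + L y" for x y using linL by (simp add: linear_add)
  have Padd: "P (x + y) = P x + P y" and Pscale: "P (c *s x) = c *s P x" for x y c
    by (simp_all add: P_def hs algebra_simps vector_add_ldistrib vec.scale_right_diff_distrib vector_sadd_rdistrib)
  have Klin: "Vector_Spaces.linear (*s) (*s) K"
  proof
    show "K (x + y) = K x + K y" for x y
      by (simp add: K_def Padd Ladd hs vector_sadd_rdistrib)
    show "K (c *s x) = c *s K x" for c x
      by (simp add: K_def Pscale LQ[OF PQ] hs vector_add_ldistrib vec.scale_right_diff_distrib)
  qed
  have KK: "K (vcnj (K (vcnj v))) = - v" for v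
  proof -
    define p where "p = P (vcnj v)"
    have pQ: "p \<in> Q" by (simp add: p_def PQ)
    define w where "w = vcnj (K (vcnj v))"
    have w: "w = vcnj (L p) + hermitian v z *s vcnj N - hermitian v N *s vcnj z
        + bil v z *s N - bil v N *s z"
      by (simp add: w_def K_def p_def hs)
    have LpQ: "vcnj (L p) \<in> Q" using pQ by (intro Qc QL)
    then have z0: "hermitian (vcnj (L p)) z = 0" "bil (vcnj (L p)) z = 0"
      "hermitian (vcnj (L p)) N = 0" "bil (vcnj (L p)) N = 0"
      by (auto simp: Q_def C_def)
    have c: "hermitian w z = - bil v N" "bil w z = - hermitian v N"
        "hermitian w N = bil v z" "bil w N = hermitian v z"
      unfolding w by (simp_all add: hermitian_simps bil_simps z0)
         (simp_all add: hermitian_vcnj_left bil_vcnj_left zz NN bzz Nz bNz hNz t)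
    have "P w = vcnj (L p)"
      unfolding P_def c by (simp add: w)
    then have "K w = - vcnj p - hermitian v N *s N - hermitian v z *s z - bil v N *s vcnj N - bil v z *s vcnj z"
      unfolding K_def c using quat[OF pQ] by simp
    also have "\<dots> = - v"
      by (simp add: p_def P_def hs)
    finally show ?thesis by (simp add: w_def)
  qed
  define A where "A = matrix K"
  have A: "K v = A *v v" for v
    using matrix_works[OF Klin] by (simp add: A_def)
  define A' where "A' = (\<chi> i j. cnj (A $ i $ j))"
  have "vcnj (A *v vcnj v) = A' *v v" for v
    by (simp add: vec_eq_iff vcnj_def A'_def matrix_vector_mult_def)
  then have AA: "(A ** A') *v v = - v" for v
    using KK[of v] by (simp only: A matrix_vector_mul_assoc)
  define D :: "complex ^ 'n ^ 'n" where "D = (\<chi> i j. if i = j then - 1 else 0)"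
  have "D *v v = - v" for v
    by (simp add: D_def vec_eq_iff matrix_vector_mult_def if_distrib[where f = "\<lambda>a. a * _"]
        cong: if_cong)
  with AA have "A ** A' = D"
    by (simp only: matrix_eq) simp
  then have "det A * det A' = det D"
    by (simp only: det_mul[symmetric])
  also have "det D = (- 1) ^ CARD('n)"
  proof (subst det_diagonal)
    show "D $ i $ j = 0" if "i \<noteq> j" for i j using that by (simp add: D_def)
    show "(\<Prod>i\<in>UNIV. D $ i $ i) = (- 1) ^ CARD('n)" by (simp add: D_def)
  qed
  also have "det A' = cnj (det A)"
    unfolding det_def A'_def by simp
  finally have "det A * cnj (det A) = - 1"
    using odd by simp
  then have "complex_of_real ((cmod (det A))\<^sup>2) = complex_of_real (- 1)"
    by (simp only: complex_norm_square of_real_minus of_real_1)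
  then have "(cmod (det A))\<^sup>2 = - 1"
    by (simp only: of_real_eq_iff)
  then show False
    using zero_le_power2[of "cmod (det A)"] by linarith
qed

end

section \<open>The cone over a hypersurface with isometric Reeb flow\<close>

text \<open>The cone \<open>K\<close> over the part of the hypersurface on which the local data are defined; \<open>F\<close> is the lift
of a local defining function.\<close>
locale quadric_cone_hypersurface =
  fixes S :: "(complex ^ 'n::finite) set" and F :: "complex ^ 'n \<Rightarrow> real" and K
  assumes K_def: "K = {z \<in> S. bil z z = 0 \<and> F z = 0}"
    and open_S: "open S" and zero_S: "0 \<notin> S"
    and smooth_F: "smooth_on S F"
    and submersion: "z \<in> K \<Longrightarrow> \<exists>v. bil v z = 0 \<and> frechet_derivative F (at z) v \<noteq> 0"
begin

abbreviation "dF w \<equiv> frechet_derivative F (at w)"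

lemma K_S: "z \<in> K \<Longrightarrow> z \<in> S"
  and K_nz: "z \<in> K \<Longrightarrow> z \<noteq> 0" and K_inner: "z \<in> K \<Longrightarrow> z \<bullet> z \<noteq> 0"
  and K_bil: "z \<in> K \<Longrightarrow> bil z z = 0"
  using zero_S by (auto simp: K_def)

lemma dF: "z \<in> S \<Longrightarrow> (F has_derivative dF z) (at z)"
  using smooth_F by (rule smooth_on_first)

text \<open>Near \<open>z\<close>, the map \<open>\<sigma>\<close> below sends the complex hyperplane \<open>bil y z = 0\<close> into the cone: the multiple of
\<open>vcnj z\<close> is the solution of \<open>bil (\<sigma> y) (\<sigma> y) = 0\<close>, a linear equation because \<open>vcnj z\<close> is itself
isotropic.  As \<open>\<sigma>\<close> is tangent to \<open>y \<mapsto> z + y\<close>, curves in the zero set of \<open>F \<circ> \<sigma>\<close> give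
curves in \<open>K\<close> with the same velocity.\<close>
lemma kernel_velocity:
  assumes z: "z \<in> K" and v: "bil v z = 0" "dF z v = 0"
  shows "v \<in> velocities K z"
proof -
  obtain w0 where w0: "bil w0 z = 0" "dF z w0 \<noteq> 0" using submersion[OF z] by blast
  define den where "den y = 2 * (hermitian z z + hermitian y z)" for y
  define \<sigma> where "\<sigma> y = z + y - (bil y y * inverse (den y)) *s vcnj z" for y
  have den0: "den 0 \<noteq> 0" using K_nz[OF z] by (simp add: den_def hermitian_self hermitian_simps)
  have der_den: "(den has_derivative (\<lambda>u. 2 * hermitian u z)) (at y)" for y
    unfolding den_def
    by (auto intro!: derivative_eq_intros has_derivative_hermitian simp: hermitian_simps)
  have cont_bil: "continuous_on A (\<lambda>y. bil y y)" for A
    by (intro bounded_bilinear.continuous_on[OF bounded_bilinear_bil] continuous_intros)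
  have cont_den: "continuous_on A den" for A
    unfolding den_def
    by (intro bounded_bilinear.continuous_on[OF bounded_bilinear_hermitian] continuous_intros)
  have der_\<sigma>: "(\<sigma> has_derivative (\<lambda>u. u)) (at 0)"
  proof -
    have i: "((\<lambda>y. inverse (den y)) has_derivative (\<lambda>u. - (inverse (den 0) * (2 * hermitian u z) * inverse (den 0)))) (at 0)"
      by (intro Deriv.has_derivative_inverse der_den den0)
    have b: "((\<lambda>y. bil y y) has_derivative (\<lambda>u. bil 0 u + bil u 0)) (at 0)"
      by (intro has_derivative_bil has_derivative_ident)
    have q: "((\<lambda>y. bil y y * inverse (den y)) has_derivative (\<lambda>u. 0)) (at 0)"
      using has_derivative_mult[OF b i] by (simp add: bil_simps)
    have "((\<lambda>y. (bil y y * inverse (den y)) *s vcnj z) has_derivative (\<lambda>u. 0)) (at 0)"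
      using has_derivative_scale[OF q has_derivative_const[of "vcnj z"]] by (simp add: bil_simps)
    then have "(\<sigma> has_derivative (\<lambda>u. 0 + u - 0)) (at 0)"
      unfolding \<sigma>_def
      by (intro has_derivative_diff has_derivative_add has_derivative_const has_derivative_ident)
    then show ?thesis by simp
  qed
  define W where "W = {y. den y \<noteq> 0} \<inter> \<sigma> -` S"
  have oden: "open {y. den y \<noteq> 0}"
    by (intro open_Collect_neq cont_den continuous_on_const)
  have cont_\<sigma>: "continuous_on {y. den y \<noteq> 0} \<sigma>"
    unfolding \<sigma>_def
    by (intro bounded_bilinear.continuous_on[OF bounded_bilinear_scale] continuous_intros cont_bil cont_den) auto
  have "open W" unfolding W_def using cont_\<sigma> oden open_S by (rule continuous_open_preimage)
  moreover have \<sigma>0: "\<sigma> 0 = z" by (simp add: \<sigma>_def bil_simps)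
  then have W0: "0 \<in> W" using den0 K_S[OF z] by (simp add: W_def)
  ultimately obtain r where r: "r > 0" "ball 0 r \<subseteq> W"
    by (meson openE)
  define G where "G y = F (\<sigma> y)" for y
  have "G 0 = 0" using z by (simp add: G_def \<sigma>0 K_def)
  moreover have derG: "(G has_derivative dF z) (at 0)"
    unfolding G_def using has_derivative_compose[OF der_\<sigma>, of F "dF z"] dF[OF K_S[OF z]] by (simp add: \<sigma>0)
  moreover have "continuous_on (ball 0 r) G"
    unfolding G_def
  proof (rule continuous_on_compose2[of S F])
    show "continuous_on S F"
      using dF by (meson continuous_at_imp_continuous_on has_derivative_continuous)
    show "continuous_on (ball 0 r) \<sigma>" using r(2) by (auto intro: continuous_on_subset[OF cont_\<sigma>] simp: W_def)
    show "\<sigma> ` ball 0 r \<subseteq> S" using r(2) by (auto simp: W_def)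
  qed
  ultimately obtain s where s: "s 0 = 0" "(s has_real_derivative 0) (at 0)"
    "\<forall>\<^sub>F t in nhds 0. G (t *\<^sub>R v + s t *\<^sub>R w0) = 0"
    using zero_curve[of G "dF z" r v w0] r(1) v(2) w0(2) by blast
  define c where "c t = t *\<^sub>R v + s t *\<^sub>R w0" for t
  have c0: "c 0 = 0" by (simp add: c_def s)
  have der_c: "(c has_derivative (\<lambda>h. h *\<^sub>R v)) (at 0)"
  proof -
    have "(s has_derivative (\<lambda>h. 0)) (at 0)"
      using s(2) by (simp add: has_field_derivative_def lambda_zero)
    then have "(c has_derivative (\<lambda>h. h *\<^sub>R v + 0 *\<^sub>R w0)) (at 0)"
      unfolding c_def
      by (intro has_derivative_add has_derivative_scaleR_left has_derivative_ident)
    then show ?thesis by simp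
  qed
  have "((\<lambda>t. \<sigma> (c t)) has_derivative (\<lambda>h. h *\<^sub>R v)) (at 0)"
    using has_derivative_compose[OF der_c, of \<sigma> "\<lambda>u. u"] der_\<sigma> by (simp add: c0)
  then have "((\<lambda>t. \<sigma> (c t)) has_vector_derivative v) (at 0)"
    by (simp add: has_vector_derivative_def)
  moreover have "\<forall>\<^sub>F t in nhds 0. \<sigma> (c t) \<in> K"
  proof -
    have "isCont c 0" using der_c by (rule has_derivative_continuous)
    then have "\<forall>\<^sub>F t in nhds 0. c t \<in> W"
      using \<open>open W\<close> W0 c0 unfolding continuous_within
      by (metis eventually_nhds_conv_at topological_tendstoD)
    with s(3) show ?thesis
    proof eventually_elim
      case (elim t)
      then have W: "c t \<in> W" and F0: "F (\<sigma> (c t)) = 0" by (simp_all add: G_def c_def)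
      have bc: "bil (c t) z = 0" by (simp add: c_def bil_simps v w0)
      have dn: "den (c t) \<noteq> 0" using W by (simp add: W_def)
      have expand: "bil (z + x - q *s vcnj z) (z + x - q *s vcnj z)
          = bil x x - q * (2 * (hermitian z z + hermitian x z))" if "bil x z = 0" for x q
      proof -
        have "bil z x = 0" using that by (simp add: bil_commute[of z x])
        then show ?thesis
          using that K_bil[OF z]
          by (simp add: bil_simps hermitian_simps bil_vcnj_left hermitian_vcnj_left
              hermitian_self hermitian_commute[of x z] algebra_simps)
      qed
      have "bil (\<sigma> (c t)) (\<sigma> (c t)) = bil (c t) (c t) -
         (bil (c t) (c t) * inverse (den (c t))) * den (c t)"
        unfolding \<sigma>_def expand[OF bc] by (simp only: den_def)
      also have "\<dots> = 0" using dn by simp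
      finally show ?case using W F0 by (simp add: K_def W_def)
    qed
  qed
  ultimately show ?thesis unfolding velocities_def using \<sigma>0 c0 by (auto intro!: exI[of _ "\<lambda>t. \<sigma> (c t)"])
qed

end

locale reeb_cone = quadric_cone_hypersurface S F K for S :: "(complex ^ 'n::finite) set" and F K +
  fixes N :: "complex ^ 'n \<Rightarrow> complex ^ 'n"
  assumes cone: "\<lbrakk>z \<in> K; c \<noteq> 0\<rbrakk> \<Longrightarrow> c *s z \<in> K"
    and smooth_N: "smooth_on S N"
    and N_scale: "\<lbrakk>z \<in> K; c \<noteq> 0\<rbrakk> \<Longrightarrow> N (c *s z) = c *s N z"
    and hNz: "z \<in> K \<Longrightarrow> hermitian (N z) z = 0"
    and bNz: "z \<in> K \<Longrightarrow> bil (N z) z = 0"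
    and NN: "z \<in> K \<Longrightarrow> N z \<bullet> N z = z \<bullet> z"
    and normal: "\<lbrakk>z \<in> K; v \<in> velocities K z\<rbrakk> \<Longrightarrow> v \<bullet> N z = 0"
    and killing: "\<lbrakk>z \<in> K; x \<in> velocities K z; y \<in> velocities K z\<rbrakk> \<Longrightarrow>
        lie_derivative (reeb_field N) fubini_study z x y = 0"
begin

abbreviation "DN w \<equiv> frechet_derivative N (at w)"
abbreviation "T w \<equiv> tangent_at w (N w)"

lemma DN: "z \<in> S \<Longrightarrow> (N has_derivative DN z) (at z)"
  using smooth_N by (rule smooth_on_first)

lemma lin_DN: "z \<in> S \<Longrightarrow> linear (DN z)"
  using DN by (rule has_derivative_linear)

text \<open>Vectors in the kernel of the derivative of \<open>F\<close> are velocities, hence orthogonal to \<open>N z\<close>.  So on the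
tangent space of the cone the two linear forms \<open>dF z\<close> and \<open>v \<bullet> N z\<close> are proportional.\<close>
lemma dF_normal:
  assumes z: "z \<in> K"
  shows "bil v z = 0 \<Longrightarrow> dF z v = dF z (N z) / (z \<bullet> z) * (v \<bullet> N z)"
    and "dF z (N z) \<noteq> 0"
proof -
  obtain w where w: "bil w z = 0" "dF z w \<noteq> 0" using submersion[OF z] by blast
  have lin: "linear (dF z)" using dF[OF K_S[OF z]] by (rule has_derivative_linear)
  have *: "v \<bullet> N z = dF z v / dF z w * (w \<bullet> N z)" if "bil v z = 0" for v
  proof -
    have "v - (dF z v / dF z w) *\<^sub>R w \<in> velocities K z"
      by (rule kernel_velocity[OF z])
        (simp_all add: bil_simps that w linear_diff[OF lin] linear_scale[OF lin])
    from normal[OF z this] show ?thesis by (simp add: inner_diff_left)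
  qed
  have n: "N z \<bullet> N z = dF z (N z) / dF z w * (w \<bullet> N z)" by (rule *[OF bNz[OF z]])
  then have nz: "dF z (N z) \<noteq> 0" "w \<bullet> N z \<noteq> 0" using NN[OF z] K_inner[OF z] by auto
  then show "dF z (N z) \<noteq> 0" by simp
  show "dF z v = dF z (N z) / (z \<bullet> z) * (v \<bullet> N z)" if "bil v z = 0"
  proof -
    have "dF z (N z) / (z \<bullet> z) = dF z w / (w \<bullet> N z)"
      using n nz w(2) K_inner[OF z] unfolding NN[OF z] by (simp add: field_simps)
    then show ?thesis using *[OF that] nz w(2) by simp
  qed
qed

lemma T_velocity: "z \<in> K \<Longrightarrow> v \<in> T z \<Longrightarrow> v \<in> velocities K z"
  using dF_normal(1)[of z v] by (auto simp: tangent_at_def intro!: kernel_velocity)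

text \<open>An identity that holds on \<open>K\<close> may be differentiated in tangent directions.  All further information on
\<open>N\<close> is obtained in this way.\<close>
lemma diff_T:
  assumes "z \<in> K" "u \<in> T z" "(\<Phi> has_derivative \<Phi>') (at z)" "\<And>w. w \<in> K \<Longrightarrow> \<Phi> w = 0"
  shows "\<Phi>' u = 0"
  using derivative_along_velocity[OF T_velocity] assms by blast

lemma DN_scale:
  assumes z: "z \<in> K" shows "DN z (c *s z) = c *s N z"
proof -
  have "((\<lambda>t. N (z + t *\<^sub>R (c *s z))) has_derivative (\<lambda>h. DN z (h *\<^sub>R (c *s z)))) (at 0)"
    by (rule has_derivative_compose[where f = "\<lambda>t. z + t *\<^sub>R (c *s z)" and g = N])
      (auto intro!: derivative_eq_intros DN K_S[OF z])
  moreover have "((\<lambda>t. N (z + t *\<^sub>R (c *s z))) has_derivative (\<lambda>h. h *\<^sub>R (c *s N z))) (at 0)"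
  proof (rule has_derivative_transform_eventually)
    show "((\<lambda>t. N z + t *\<^sub>R (c *s N z)) has_derivative (\<lambda>h. h *\<^sub>R (c *s N z))) (at 0)"
      by (auto intro!: derivative_eq_intros)
    have "\<forall>\<^sub>F t in nhds 0. 1 + of_real t * c \<noteq> 0"
    proof -
      have "isCont (\<lambda>t. 1 + of_real t * c) 0" by (intro continuous_intros)
      then have "\<forall>\<^sub>F t in at 0. 1 + of_real t * c \<noteq> 0"
        unfolding isCont_def by (intro tendsto_imp_eventually_ne) auto
      then show ?thesis unfolding eventually_nhds_conv_at by simp
    qed
    then have "\<forall>\<^sub>F t in nhds 0. N z + t *\<^sub>R (c *s N z) = N (z + t *\<^sub>R (c *s z))"
    proof eventually_elim
      case (elim t)
      have "z + t *\<^sub>R (c *s z) = (1 + of_real t * c) *s z" for z :: "complex ^ 'n"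
        by (simp add: vec_eq_iff algebra_simps scaleR_conv_of_real[where 'a = complex])
      then show ?case using N_scale[OF z elim] by simp
    qed
    then show "\<forall>\<^sub>F t in at 0. N z + t *\<^sub>R (c *s N z) = N (z + t *\<^sub>R (c *s z))"
      by (simp add: eventually_nhds_conv_at)
  qed auto
  ultimately have "(\<lambda>h. DN z (h *\<^sub>R (c *s z))) = (\<lambda>h. h *\<^sub>R (c *s N z))"
    by (rule has_derivative_unique)
  from fun_cong[OF this, of 1] show ?thesis by simp
qed

lemma T_scale: "z \<in> K \<Longrightarrow> c *s z \<in> T z"
  using K_bil hNz[of z] hermitian_commute[of z "N z"]
  by (simp add: tangent_at_def bil_simps inner_eq_Re_hermitian hermitian_simps)

lemma first_hermitian:
  assumes z: "z \<in> K" and x: "x \<in> T z" shows "hermitian (DN z x) z = - hermitian (N z) x"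
  using diff_T[OF z x has_derivative_hermitian[OF DN[OF K_S[OF z]] has_derivative_ident] hNz]
  by (simp add: add_eq_0_iff)

lemma first_bil:
  assumes z: "z \<in> K" and x: "x \<in> T z" shows "bil (DN z x) z = - bil (N z) x"
  using diff_T[OF z x has_derivative_bil[OF DN[OF K_S[OF z]] has_derivative_ident] bNz]
  by (simp add: add_eq_0_iff)

lemma first_norm:
  assumes z: "z \<in> K" and x: "x \<in> T z" shows "DN z x \<bullet> N z = x \<bullet> z"
proof -
  have "((\<lambda>w. N w \<bullet> N w - w \<bullet> w) has_derivative (\<lambda>u. (N z \<bullet> DN z u + DN z u \<bullet> N z) - (z \<bullet> u + u \<bullet> z))) (at z)"
    by (intro has_derivative_diff has_derivative_inner DN K_S[OF z] has_derivative_ident)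
  from diff_T[OF z x this] show ?thesis by (simp add: NN inner_commute)
qed

text \<open>Differentiating \<open>dF w (Y w) = \<rho> w * (Y w \<bullet> N w)\<close>, for a field \<open>Y\<close> tangent to the quadric cone with
\<open>Y z\<close> a multiple of \<open>y\<close>, expresses \<open>y \<bullet> DN z u\<close> by the second derivative of \<open>F\<close>, which is
symmetric.\<close>
lemma shape_symmetric:
  assumes z: "z \<in> K" and x: "x \<in> T z" and y: "y \<in> T z"
  shows "DN z x \<bullet> y = DN z y \<bullet> x"
proof -
  let ?c = "inverse (z \<bullet> z)"
  define D2 where "D2 = (\<lambda>u y. frechet_derivative (\<lambda>w. dF w y) (at z) u)"
  have D2: "((\<lambda>w. dF w y) has_derivative (\<lambda>u. D2 u y)) (at z)" for y
    unfolding D2_def using smooth_on_second[OF smooth_F K_S[OF z], of y] .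
  have D2sym: "D2 u y = D2 y u" for u y
    using second_derivative_symmetric[OF open_S K_S[OF z] dF D2 D2] .
  note nz = K_inner[OF z]
  define \<rho> where "\<rho> w = dF w (N w) * inverse (w \<bullet> w)" for w
  have "\<exists>\<rho>'. (\<rho> has_derivative \<rho>') (at z)"
  proof -
    have d1: "((\<lambda>w. dF w (N w)) has_derivative (\<lambda>u. D2 u (N z) + dF z (DN z u))) (at z)"
      using dF DN[OF K_S[OF z]]
      by (intro has_derivative_moving[OF open_S K_S[OF z]] D2) (auto dest: has_derivative_linear)
    have d2: "((\<lambda>w. w \<bullet> w) has_derivative (\<lambda>u. z \<bullet> u + u \<bullet> z)) (at z)"
      by (intro has_derivative_inner has_derivative_ident)
    show ?thesis unfolding \<rho>_def
      by (rule exI, rule has_derivative_mult[OF d1 Deriv.has_derivative_inverse[OF nz d2]])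
  qed
  then obtain \<rho>' where \<rho>': "(\<rho> has_derivative \<rho>') (at z)" by blast
  have \<rho>0: "\<rho> z \<noteq> 0" using dF_normal(2)[OF z] nz by (simp add: \<rho>_def)
  have dF_\<rho>: "dF w v = \<rho> w * (v \<bullet> N w)" if "w \<in> K" "bil v w = 0" for w v
    using dF_normal(1)[OF that] by (simp add: \<rho>_def divide_inverse)
  have linF: "linear (dF z)" using dF[OF K_S[OF z]] by (rule has_derivative_linear)
  define e :: "complex ^ 'n \<Rightarrow> complex ^ 'n \<Rightarrow> complex ^ 'n" where "e x u = - (bil x u *s vcnj z)" for x u
  have main: "\<rho> z * (z \<bullet> z) * (y \<bullet> DN z u) = (z \<bullet> z) * D2 u y + dF z (e y u) - \<rho> z * (e y u \<bullet> N z)"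
    if y: "y \<in> T z" and u: "u \<in> T z" for y u
  proof -
    have yz: "bil y z = 0" "y \<bullet> N z = 0" using y by (simp_all add: tangent_at_def)
    define Y where "Y w = (w \<bullet> w) *\<^sub>R y - bil y w *s vcnj w" for w
    define Y' where "Y' u = (z \<bullet> u + u \<bullet> z) *\<^sub>R y - (bil y z *s vcnj u + (bil y u + bil 0 z) *s vcnj z)" for u
    have Y: "(Y has_derivative Y') (at z)"
      unfolding Y_def Y'_def
      by (intro has_derivative_diff has_derivative_scaleR_left has_derivative_inner has_derivative_ident
          has_derivative_scale has_derivative_bil has_derivative_const has_derivative_vcnj)
    have Yz: "Y z = (z \<bullet> z) *\<^sub>R y" by (simp add: Y_def yz)
    have Y'u: "Y' u = (2 * (z \<bullet> u)) *\<^sub>R y + e y u"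
      by (simp add: Y'_def yz e_def bil_simps inner_commute)
    have d1: "((\<lambda>w. dF w (Y w)) has_derivative (\<lambda>u. D2 u (Y z) + dF z (Y' u))) (at z)"
      using dF
      by (intro has_derivative_moving[OF open_S K_S[OF z]] D2 Y) (auto dest: has_derivative_linear)
    have "((\<lambda>w. dF w (Y w) - \<rho> w * (Y w \<bullet> N w)) has_derivative
        (\<lambda>u. (D2 u (Y z) + dF z (Y' u)) - (\<rho> z * (Y z \<bullet> DN z u + Y' u \<bullet> N z) + \<rho>' u * (Y z \<bullet> N z)))) (at z)"
      by (intro has_derivative_diff d1 has_derivative_mult \<rho>' has_derivative_inner Y DN K_S[OF z])
    moreover have "dF w (Y w) - \<rho> w * (Y w \<bullet> N w) = 0" if "w \<in> K" for w
    proof -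
      have "bil (Y w) w = 0"
        by (simp add: Y_def bil_simps bil_vcnj_left hermitian_self)
      from dF_\<rho>[OF that this] show ?thesis by simp
    qed
    ultimately have "(D2 u (Y z) + dF z (Y' u)) - (\<rho> z * (Y z \<bullet> DN z u + Y' u \<bullet> N z) + \<rho>' u * (Y z \<bullet> N z)) = 0"
      by (rule diff_T[OF z u])
    moreover have "D2 u (Y z) = (z \<bullet> z) * D2 u y"
      unfolding D2sym[of u] Yz
      using linear_scale[OF has_derivative_linear[OF D2[of u]]] by simp
    moreover have "dF z (Y' u) = dF z (e y u)"
      using dF_\<rho>[OF z yz(1)] by (simp add: Y'u linear_add[OF linF] linear_scale[OF linF] yz)
    moreover have "Y' u \<bullet> N z = e y u \<bullet> N z" by (simp add: Y'u inner_add_left yz)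
    moreover have "Y z \<bullet> N z = 0" "Y z \<bullet> DN z u = (z \<bullet> z) * (y \<bullet> DN z u)" by (simp_all add: Yz yz)
    ultimately show ?thesis by (simp add: algebra_simps)
  qed
  have "e x y = e y x" by (simp add: e_def bil_commute)
  then have "\<rho> z * (z \<bullet> z) * (y \<bullet> DN z x) = \<rho> z * (z \<bullet> z) * (x \<bullet> DN z y)"
    unfolding main[OF y x] main[OF x y] D2sym[of x y] by simp
  then show ?thesis using \<rho>0 nz by (simp add: inner_commute)
qed

text \<open>For horizontal vectors, the Lie derivative of the Fubini-Study metric is that of the flat metric, up to
the factor \<open>1 / (z \<bullet> z)\<close>.  On vertical vectors, where \<open>N\<close> is homogeneous, the equation holds
automatically; hence it holds on all of \<open>T z\<close>, and can be differentiated along fields that are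
tangent to \<open>K\<close> without being horizontal.\<close>
lemma killing_tangent:
  assumes z: "z \<in> K" and x: "x \<in> T z" and y: "y \<in> T z"
  shows "DN z x \<bullet> (\<i> *s y) + DN z y \<bullet> (\<i> *s x) = 0"
proof -
  note lin = lin_DN[OF K_S[OF z]]
  have Dreeb: "frechet_derivative (reeb_field N) (at z) = (\<lambda>u. - (\<i> *s DN z u))"
  proof (rule frechet_derivative_at[symmetric])
    show "(reeb_field N has_derivative (\<lambda>u. - (\<i> *s DN z u))) (at z)"
      unfolding reeb_field_def complex_structure_def
      by (intro has_derivative_minus DN K_S[OF z]
          bounded_linear.has_derivative[OF bounded_bilinear.bounded_linear_right[OF bounded_bilinear_scale]])
  qed
  have horizontal: "DN z x \<bullet> (\<i> *s y) + DN z y \<bullet> (\<i> *s x) = 0"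
    if x: "x \<in> T z" "hermitian x z = 0" and y: "y \<in> T z" "hermitian y z = 0" for x y
  proof -
    have "hermitian (reeb_field N z) z = 0"
      by (simp add: reeb_field_def complex_structure_def hermitian_simps hNz[OF z])
    then have "lie_derivative (reeb_field N) fubini_study z x y
      = ((- (\<i> *s DN z x)) \<bullet> y + x \<bullet> (- (\<i> *s DN z y))) / (z \<bullet> z)"
      unfolding lie_derivative_def Dreeb fubini_study_orthogonal(1)[OF y(2) K_nz[OF z]]
        fubini_study_orthogonal(2)[OF x(2) K_nz[OF z]]
      using fubini_study_derivative_orthogonal[OF K_nz[OF z] x(2) y(2)]
      by (simp add: add_divide_distrib diff_divide_distrib)
    with killing[OF z T_velocity[OF z x(1)] T_velocity[OF z y(1)]] K_inner[OF z]
    have "(- (\<i> *s DN z x)) \<bullet> y + x \<bullet> (- (\<i> *s DN z y)) = 0" by simp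
    moreover have "DN z x \<bullet> (\<i> *s y) = (- (\<i> *s DN z x)) \<bullet> y"
      by (simp only: inner_scale_i(1) inner_minus_left)
    moreover have "DN z y \<bullet> (\<i> *s x) = x \<bullet> (- (\<i> *s DN z y))"
      by (simp only: inner_scale_i(1) inner_minus_left[symmetric] inner_commute[of x])
    ultimately show ?thesis by simp
  qed
  have vertical: "DN z x \<bullet> (\<i> *s (d *s z)) + DN z (d *s z) \<bullet> (\<i> *s x) = 0" if x: "x \<in> T z" for x d
  proof -
    have "Re (hermitian (N z) x) = 0"
      using x by (simp add: tangent_at_def inner_commute flip: inner_eq_Re_hermitian)
    then show ?thesis
      using first_hermitian[OF z x] unfolding DN_scale[OF z]
      by (simp add: inner_eq_Re_hermitian hermitian_simps)
  qed
  define c where "c x = hermitian x z / hermitian z z" for x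
  have zz: "hermitian z z \<noteq> 0" using K_nz[OF z] by (simp add: hermitian_self)
  have split: "x - c x *s z \<in> T z" "hermitian (x - c x *s z) z = 0" if "x \<in> T z" for x
    using that T_scale[OF z, of "c x"] zz
    by (simp_all add: tangent_at_def bil_simps inner_diff_left hermitian_simps c_def)
  have add: "DN z a = DN z (a - b) + DN z b" "\<i> *s a = \<i> *s (a - b) + \<i> *s b" for a b
    by (simp_all add: linear_diff[OF lin] vec.scale_right_diff_distrib)
  have "DN z (x - c x *s z) \<bullet> (\<i> *s y) + DN z y \<bullet> (\<i> *s (x - c x *s z)) = 0"
    using horizontal[OF split[OF x] split[OF y]] vertical[OF split(1)[OF x], of "c y"]
    unfolding add[of y "c y *s z"] inner_add_left inner_add_right by linarith
  then show ?thesis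
    using vertical[OF y, of "c x"]
    unfolding add[of x "c x *s z"] inner_add_left inner_add_right by linarith
qed

definition "horizontal_tangent z = {v \<in> T z. v \<bullet> z = 0}"

text \<open>A polynomial in the real coordinates of \<open>w\<close> and \<open>N w\<close> that on \<open>K\<close> is \<open>w \<bullet> w\<close> times the orthogonal projection of \<open>x\<close> to
\<open>T w\<close>.  At points of norm 1, its derivative in a horizontal direction \<open>u\<close> is symmetric in \<open>u\<close> and \<open>x\<close>
for horizontal tangent \<open>x\<close>, so that no commutator terms appear in the second derivatives.\<close>
definition "tangent_field x w = (w \<bullet> w) *\<^sub>R x - bil x w *s vcnj w - (x \<bullet> N w) *\<^sub>R N w"

definition "tangent_field_deriv z u x = (2 * (z \<bullet> u)) *\<^sub>R x - (bil x z *s vcnj u + bil x u *s vcnj z)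
  - ((x \<bullet> N z) *\<^sub>R DN z u + (x \<bullet> DN z u) *\<^sub>R N z)"

definition "normal_hessian z u x = frechet_derivative (\<lambda>w. DN w x) (at z) u + DN z (tangent_field_deriv z u x)"

lemma tangent_field_T: "w \<in> K \<Longrightarrow> tangent_field x w \<in> T w"
  using hNz[of w] bNz[of w] NN[of w] hermitian_commute[of "vcnj w" "N w"]
  by (simp add: tangent_at_def tangent_field_def bil_simps bil_vcnj_left hermitian_self inner_diff_left
      inner_eq_Re_hermitian[of "_ *s _"] hermitian_simps hermitian_vcnj_left)

context
  fixes z assumes z: "z \<in> K" and unit: "z \<bullet> z = 1"
begin

lemma tangent_field_at: "x \<in> T z \<Longrightarrow> tangent_field x z = x"
  by (simp add: tangent_field_def tangent_at_def unit)

lemma tangent_field_derivative: "(tangent_field x has_derivative (\<lambda>u. tangent_field_deriv z u x)) (at z)"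
proof -
  have "(tangent_field x has_derivative (\<lambda>u. (z \<bullet> u + u \<bullet> z) *\<^sub>R x - (bil x z *s vcnj u + (bil x u + bil 0 z) *s vcnj z)
       - ((x \<bullet> N z) *\<^sub>R DN z u + (x \<bullet> DN z u) *\<^sub>R N z))) (at z)"
    unfolding tangent_field_def
    by (intro has_derivative_diff has_derivative_scaleR_left has_derivative_inner has_derivative_ident
          has_derivative_scaleR has_derivative_inner_right DN K_S[OF z]
          has_derivative_scale has_derivative_bil has_derivative_const has_derivative_vcnj)
  then show ?thesis by (simp add: tangent_field_deriv_def bil_simps inner_commute[of _ z])
qed

lemma horT: "x \<in> horizontal_tangent z \<Longrightarrow> x \<in> T z"
  by (simp add: horizontal_tangent_def)

lemma tangent_field_deriv_horizontal:
  assumes "u \<in> horizontal_tangent z" "x \<in> T z"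
  shows "tangent_field_deriv z u x = - (bil x u *s vcnj z + (x \<bullet> DN z u) *\<^sub>R N z)"
  using assms by (simp add: tangent_field_deriv_def horizontal_tangent_def tangent_at_def inner_commute)

lemma D2N: "((\<lambda>w. DN w y) has_derivative (\<lambda>u. frechet_derivative (\<lambda>w. DN w y) (at z) u)) (at z)"
  using smooth_on_second[OF smooth_N K_S[OF z], of y] .

lemma normal_hessian_derivative:
  assumes x: "x \<in> T z"
  shows "((\<lambda>w. DN w (tangent_field x w)) has_derivative (\<lambda>u. normal_hessian z u x)) (at z)"
  using has_derivative_moving[OF open_S K_S[OF z] lin_DN D2N tangent_field_derivative[of x]]
  unfolding tangent_field_at[OF x] normal_hessian_def .

lemma normal_hessian_symmetric:
  assumes x: "x \<in> horizontal_tangent z" and u: "u \<in> horizontal_tangent z"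
  shows "normal_hessian z u x = normal_hessian z x u"
proof -
  have "tangent_field_deriv z u x = tangent_field_deriv z x u"
    using shape_symmetric[OF z horT[OF x] horT[OF u]]
    by (simp add: tangent_field_deriv_horizontal horT x u bil_commute[of x u] inner_commute)
  moreover have "frechet_derivative (\<lambda>w. DN w x) (at z) u = frechet_derivative (\<lambda>w. DN w u) (at z) x"
    using second_derivative_symmetric_vector[OF open_S K_S[OF z] DN D2N D2N] .
  ultimately show ?thesis by (simp add: normal_hessian_def)
qed

lemma normal_hessian_norm:
  assumes u: "u \<in> horizontal_tangent z" and x: "x \<in> horizontal_tangent z"
  shows "normal_hessian z u x \<bullet> N z + DN z x \<bullet> DN z u = x \<bullet> u"
proof -
  have "((\<lambda>w. DN w (tangent_field x w) \<bullet> N w - tangent_field x w \<bullet> w) has_derivative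
     (\<lambda>u. (DN z (tangent_field x z) \<bullet> DN z u + normal_hessian z u x \<bullet> N z) - (tangent_field x z \<bullet> u + tangent_field_deriv z u x \<bullet> z))) (at z)"
    by (intro has_derivative_diff has_derivative_inner normal_hessian_derivative[OF horT[OF x]]
        tangent_field_derivative DN K_S[OF z] has_derivative_ident)
  from diff_T[OF z horT[OF u] this]
  have "(DN z x \<bullet> DN z u + normal_hessian z u x \<bullet> N z) - (x \<bullet> u + tangent_field_deriv z u x \<bullet> z) = 0"
    by (simp add: first_norm tangent_field_T tangent_field_at horT[OF x])
  moreover have "tangent_field_deriv z u x \<bullet> z = 0"
    using hNz[OF z] K_bil[OF z]
    by (simp add: tangent_field_deriv_horizontal u horT[OF x] inner_add_left
        inner_eq_Re_hermitian[of _ z] hermitian_simps hermitian_vcnj_left)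
  ultimately show ?thesis by simp
qed

lemma normal_hessian_shape:
  assumes u: "u \<in> horizontal_tangent z" and x: "x \<in> T z" and y: "y \<in> T z"
  shows "normal_hessian z u x \<bullet> y + DN z x \<bullet> tangent_field_deriv z u y = normal_hessian z u y \<bullet> x + DN z y \<bullet> tangent_field_deriv z u x"
proof -
  have "((\<lambda>w. DN w (tangent_field x w) \<bullet> tangent_field y w - DN w (tangent_field y w) \<bullet> tangent_field x w) has_derivative
     (\<lambda>u. (DN z (tangent_field x z) \<bullet> tangent_field_deriv z u y + normal_hessian z u x \<bullet> tangent_field y z)
        - (DN z (tangent_field y z) \<bullet> tangent_field_deriv z u x + normal_hessian z u y \<bullet> tangent_field x z))) (at z)"
    by (intro has_derivative_diff has_derivative_inner normal_hessian_derivative x y tangent_field_derivative)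
  from diff_T[OF z horT[OF u] this]
  have "(DN z (tangent_field x z) \<bullet> tangent_field_deriv z u y + normal_hessian z u x \<bullet> tangent_field y z)
        - (DN z (tangent_field y z) \<bullet> tangent_field_deriv z u x + normal_hessian z u y \<bullet> tangent_field x z) = 0"
    by (simp add: shape_symmetric[OF _ tangent_field_T[of _ x] tangent_field_T[of _ y]])
  then show ?thesis unfolding tangent_field_at[OF x] tangent_field_at[OF y] by linarith
qed

lemma normal_hessian_kill:
  assumes u: "u \<in> horizontal_tangent z" and x: "x \<in> T z" and y: "y \<in> T z"
  shows "normal_hessian z u x \<bullet> (\<i> *s y) + DN z x \<bullet> (\<i> *s tangent_field_deriv z u y)
    + (normal_hessian z u y \<bullet> (\<i> *s x) + DN z y \<bullet> (\<i> *s tangent_field_deriv z u x)) = 0"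
proof -
  note scale = bounded_linear.has_derivative[OF bounded_bilinear.bounded_linear_right[OF bounded_bilinear_scale]]
  have "((\<lambda>w. DN w (tangent_field x w) \<bullet> (\<i> *s tangent_field y w) + DN w (tangent_field y w) \<bullet> (\<i> *s tangent_field x w)) has_derivative
     (\<lambda>u. (DN z (tangent_field x z) \<bullet> (\<i> *s tangent_field_deriv z u y) + normal_hessian z u x \<bullet> (\<i> *s tangent_field y z))
       + (DN z (tangent_field y z) \<bullet> (\<i> *s tangent_field_deriv z u x) + normal_hessian z u y \<bullet> (\<i> *s tangent_field x z)))) (at z)"
    by (intro has_derivative_add has_derivative_inner scale normal_hessian_derivative x y tangent_field_derivative)
  from diff_T[OF z horT[OF u] this killing_tangent[OF _ tangent_field_T tangent_field_T]]
  show ?thesis unfolding tangent_field_at[OF x] tangent_field_at[OF y] by linarith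
qed

text \<open>At points of norm 1, the derivatives of the normal field have the pointwise properties from which
the algebraic part of the proof starts.\<close>
lemma reeb_jet: "reeb_jet z (N z) (DN z) (normal_hessian z)"
proof -
  have scale_minus: "\<i> *s (- a) = - (\<i> *s a)" for a :: "complex ^ 'n" by (simp add: vec_eq_iff)
  show ?thesis
    unfolding reeb_jet_def horizontal_tangent_def[symmetric]
  proof (intro conjI allI impI)
    show "hermitian z z = 1" "hermitian (N z) (N z) = 1"
      by (simp_all add: hermitian_self NN[OF z] unit)
    show "bil z z = 0" "hermitian (N z) z = 0" "bil (N z) z = 0" "linear (DN z)"
      using K_bil[OF z] hNz[OF z] bNz[OF z] lin_DN[OF K_S[OF z]] by auto
  next
    fix x assume x: "x \<in> horizontal_tangent z"
    note xT = horT[OF x]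
    show "hermitian (DN z x) z = - hermitian (N z) x" "bil (DN z x) z = - bil (N z) x"
      by (rule first_hermitian[OF z xT] first_bil[OF z xT])+
    show "DN z x \<bullet> N z = 0" using first_norm[OF z xT] x by (simp add: horizontal_tangent_def)
    fix y assume y: "y \<in> horizontal_tangent z"
    note yT = horT[OF y]
    note e = tangent_field_deriv_horizontal[OF x]
    show "DN z x \<bullet> y = DN z y \<bullet> x" by (rule shape_symmetric[OF z xT yT])
    show "DN z x \<bullet> (\<i> *s y) + DN z y \<bullet> (\<i> *s x) = 0" by (rule killing_tangent[OF z xT yT])
    show "normal_hessian z x y = normal_hessian z y x" by (rule normal_hessian_symmetric[OF y x])
    show "normal_hessian z x y \<bullet> N z + DN z y \<bullet> DN z x = y \<bullet> x" by (rule normal_hessian_norm[OF x y])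
    fix v assume v: "v \<in> horizontal_tangent z"
    show "normal_hessian z x y \<bullet> v - DN z y \<bullet> (bil v x *s vcnj z + (v \<bullet> DN z x) *\<^sub>R N z) =
       normal_hessian z x v \<bullet> y - DN z v \<bullet> (bil y x *s vcnj z + (y \<bullet> DN z x) *\<^sub>R N z)"
      using normal_hessian_shape[OF x yT horT[OF v]] unfolding e[OF yT] e[OF horT[OF v]] inner_minus_right by simp
    show "normal_hessian z x y \<bullet> (\<i> *s v) - DN z y \<bullet> (\<i> *s (bil v x *s vcnj z + (v \<bullet> DN z x) *\<^sub>R N z)) +
       normal_hessian z x v \<bullet> (\<i> *s y) - DN z v \<bullet> (\<i> *s (bil y x *s vcnj z + (y \<bullet> DN z x) *\<^sub>R N z)) = 0"
      using normal_hessian_kill[OF x yT horT[OF v]]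
      unfolding e[OF yT] e[OF horT[OF v]] scale_minus inner_minus_right by linarith
  qed
qed

end

lemma rescale_to_unit:
  assumes "w \<in> K"
  obtains r where "r > 0" "of_real r *s w \<in> K" "(of_real r *s w) \<bullet> (of_real r *s w) = 1"
proof
  let ?r = "inverse (norm w)"
  show "?r > 0" using K_nz[OF assms] by simp
  then show "of_real ?r *s w \<in> K" by (intro cone assms) simp
  have "of_real ?r *s w = ?r *\<^sub>R w" by (simp add: vec_eq_iff scaleR_conv_of_real[where 'a = complex])
  then show "(of_real ?r *s w) \<bullet> (of_real ?r *s w) = 1"
    using K_nz[OF assms] by (simp add: dot_square_norm power2_eq_square)
qed

lemma isotropic:
  assumes n: "CARD('n) \<ge> 5" and w: "w \<in> K" shows "bil (N w) (N w) = 0"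
proof -
  obtain r where r: "r > 0" "of_real r *s w \<in> K" "(of_real r *s w) \<bullet> (of_real r *s w) = 1"
    by (rule rescale_to_unit[OF w])
  have "bil (N (of_real r *s w)) (N (of_real r *s w)) = 0"
    by (rule reeb_jet.bil_NN_zero[OF reeb_jet[OF r(2,3)] n])
  then show ?thesis using r(1) N_scale[OF w, of "of_real r"] by (simp add: bil_simps)
qed

lemma cone_empty_if_odd:
  assumes n: "CARD('n) \<ge> 5" "odd CARD('n)" shows "K = {}"
proof (rule ccontr)
  assume "K \<noteq> {}"
  then obtain z where z: "z \<in> K" and unit: "z \<bullet> z = 1"
    using rescale_to_unit by blast
  note t = isotropic[OF n(1)]
  have t1: "bil (DN w x) (N w) = 0" if w: "w \<in> K" and x: "x \<in> T w" for w x
    using diff_T[OF w x has_derivative_bil[OF DN[OF K_S[OF w]] DN[OF K_S[OF w]]] t]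
    by (simp add: bil_commute[of "N w"])
  have t2: "bil (normal_hessian z u x) (N z) + bil (DN z x) (DN z u) = 0"
    if u: "u \<in> horizontal_tangent z" and x: "x \<in> horizontal_tangent z" for u x
  proof -
    note xT = horT[OF z unit x]
    from diff_T[OF z horT[OF z unit u] has_derivative_bil[OF normal_hessian_derivative[OF z unit xT] DN[OF K_S[OF z]]]
        t1[OF _ tangent_field_T]]
    show ?thesis by (simp add: tangent_field_at[OF z unit xT] add.commute)
  qed
  show False
    by (rule reeb_jet.isotropic_contradiction[OF reeb_jet[OF z unit] n(2) t[OF z]])
      (use t1[OF z] t2 in \<open>auto simp: horizontal_tangent_def\<close>)
qed

end

section \<open>Hypersurfaces of the quadric\<close>

lemma proj_point_scale:
  fixes z :: "complex ^ 'n::finite"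
  assumes "c \<noteq> 0" shows "proj_point (c *s z) = proj_point z"
proof -
  have "z = inverse c *s (c *s z)" using assms by (simp add: vector_smult_assoc)
  then have "z \<in> vec.span {c *s z}" by (metis vec.span_base vec.span_scale singletonI)
  moreover have "c *s z \<in> vec.span {z}" by (simp add: vec.span_base vec.span_scale)
  ultimately show ?thesis by (simp add: proj_point_def vec.span_eq)
qed

lemma proj_point_in_quadric:
  fixes z :: "complex ^ 'n::finite"
  assumes "z \<noteq> 0" shows "proj_point z \<in> complex_quadric \<longleftrightarrow> bil z z = 0"
proof
  assume "bil z z = 0"
  then show "proj_point z \<in> complex_quadric"
    using assms unfolding complex_quadric_def bil_def by (auto simp: power2_eq_square)
next
  assume "proj_point z \<in> complex_quadric"
  then obtain w where w: "proj_point z = proj_point w" "bil w w = 0"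
    unfolding complex_quadric_def bil_def by (auto simp: power2_eq_square)
  have "z \<in> vec.span {w}"
    using w(1) vec.span_base[of z "{z}"] by (simp add: proj_point_def)
  then obtain c where "z = c *s w" by (auto simp: vec.span_singleton)
  then show "bil z z = 0" by (simp add: bil_simps w)
qed

lemma lifted_tangent_velocities: "lifted_tangent M z = velocities (proj_preimage M) z"
  by (simp add: lifted_tangent_def velocities_def)

lemma tangent_quadric:
  fixes z :: "complex ^ 'n::finite"
  assumes "v \<in> lifted_tangent complex_quadric z" shows "bil v z = 0"
proof -
  have "((\<lambda>w. bil w w) has_derivative (\<lambda>u. bil z u + bil u z)) (at z)"
    by (intro has_derivative_bil has_derivative_ident)
  moreover have "bil w w = 0" if "w \<in> proj_preimage complex_quadric" for w :: "complex ^ 'n"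
    using that by (auto simp: proj_preimage_def proj_point_in_quadric)
  ultimately have "bil z v + bil v z = 0"
    by (rule derivative_along_velocity[OF assms[unfolded lifted_tangent_velocities]])
  then show ?thesis by (simp add: bil_commute[of z])
qed

theorem corollary1p3:
  fixes k :: nat
  assumes "k \<ge> 1" and "CARD('n::finite) = (2 * k + 1) + 2"
  shows "\<not> (\<exists>M :: (complex ^ 'n) set set.
            M \<noteq> {} \<and> real_hypersurface M \<and> isometric_reeb_flow M)"
proof
  assume "\<exists>M :: (complex ^ 'n) set set. M \<noteq> {} \<and> real_hypersurface M \<and> isometric_reeb_flow M"
  then obtain M :: "(complex ^ 'n) set set" and p
    where p: "p \<in> M" and hyp: "real_hypersurface M" and reeb: "isometric_reeb_flow M" by blast
  from hyp p obtain U and f :: "(complex ^ 'n) set \<Rightarrow> real"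
    where MQ: "M \<subseteq> complex_quadric" and U: "open_in_proj U" "p \<in> U"
      and f: "smooth_on (proj_preimage U) (\<lambda>z. f (proj_point z))"
      and MU: "M \<inter> U = {q \<in> complex_quadric \<inter> U. f q = 0}"
      and sub: "\<And>z. z \<in> proj_preimage (M \<inter> U) \<Longrightarrow> \<exists>v\<in>lifted_tangent complex_quadric z.
           frechet_derivative (\<lambda>w. f (proj_point w)) (at z) v \<noteq> 0"
    unfolding real_hypersurface_def by meson
  from reeb p obtain U' N where U': "p \<in> U'" and N: "unit_normal_field M U' N"
    and kill: "killing_field_on M U' (reeb_field N)"
    unfolding isometric_reeb_flow_def by blast
  define S where "S = proj_preimage U \<inter> proj_preimage U'"
  define F where "F z = f (proj_point z)" for z
  define K where "K = {z \<in> S. bil z z = 0 \<and> F z = 0}"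
  have K: "K = proj_preimage M \<inter> S"
    using MU MQ by (auto simp: K_def S_def proj_preimage_def F_def proj_point_in_quadric)
  have KU: "z \<in> proj_preimage (M \<inter> U)" "z \<in> proj_preimage (M \<inter> U')" "z \<noteq> 0" if "z \<in> K" for z
    using that unfolding K by (auto simp: S_def proj_preimage_def)
  have KM: "velocities K z \<subseteq> lifted_tangent M z" for z
    unfolding lifted_tangent_velocities K by (rule velocities_mono) simp
  note N = N[unfolded unit_normal_field_def]
  have N': "\<And>c. c \<noteq> 0 \<Longrightarrow> N (c *s z) = c *s N z" "hermitian (N z) z = 0"
        "N z \<in> lifted_tangent complex_quadric z"
        "\<And>v. v \<in> lifted_tangent M z \<Longrightarrow> fubini_study z (N z) v = 0"
        "fubini_study z (N z) (N z) = 1" if "z \<in> K" for z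
    using N KU(2)[OF that] by blast+
  have "reeb_cone S F K N"
  proof
    show "open S" using U N by (auto simp: S_def open_in_proj_def)
    show "0 \<notin> S" by (simp add: S_def proj_preimage_def)
    show "smooth_on S F" using smooth_on_subset[OF f] by (simp add: S_def F_def[abs_def])
    show "smooth_on S N" using N smooth_on_subset[of "proj_preimage U'" N S] by (simp add: S_def)
  next
    fix z assume z: "z \<in> K"
    show "\<exists>v. bil v z = 0 \<and> frechet_derivative F (at z) v \<noteq> 0"
      using sub[OF KU(1)[OF z]] tangent_quadric unfolding F_def[abs_def] by blast
  next
    fix z assume z: "z \<in> K"
    note nz = KU(3)[OF z]
    show "c *s z \<in> K" "N (c *s z) = c *s N z" if "c \<noteq> 0" for c
      using z that N'(1)[OF z that] proj_point_scale[OF that, of z]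
      by (auto simp: K_def S_def F_def proj_preimage_def bil_simps vector_mul_eq_0)
    show "hermitian (N z) z = 0" by (rule N'(2)[OF z])
    show "bil (N z) z = 0" by (rule tangent_quadric[OF N'(3)[OF z]])
    show "N z \<bullet> N z = z \<bullet> z"
      using N'(5)[OF z] nz by (simp add: fubini_study_orthogonal[OF N'(2)[OF z] nz])
    show "v \<bullet> N z = 0" if "v \<in> velocities K z" for v
      using N'(4)[OF z, of v] KM[of z] that nz
      by (auto simp: fubini_study_orthogonal[OF N'(2)[OF z] nz] inner_commute)
    show "lie_derivative (reeb_field N) fubini_study z x y = 0"
      if "x \<in> velocities K z" "y \<in> velocities K z" for x y
      using kill that KM KU(2)[OF z] unfolding killing_field_on_def by blast
  qed (rule K_def)
  then have "K = {}"
    by (rule reeb_cone.cone_empty_if_odd) (use assms in auto)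
  moreover have "K \<noteq> {}"
  proof -
    obtain z where "z \<noteq> 0" "p = proj_point z"
      using p MQ unfolding complex_quadric_def by blast
    then show ?thesis using p U(2) U' unfolding K by (auto simp: S_def proj_preimage_def)
  qed
  ultimately show False by simp
qed

end
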